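(* For every link $L$, $$t_C(L) + \operatorname{caps}(L) \leq t(L).$$
   Context: Links are nonempty tame links in $S^3$, unoriented and considered up to ambient isotopy. Edge tiles. There are 11 edge tiles $T_0,\dots,T_{10}$, each a unit square carrying curves whose endpoints are midpoints of its sides: $T_0$ is empty; $T_1,T_2,T_3,T_4$ each carry a single arc joining the midpoints of two adjacent sides (respectively left/bottom, bottom/right, right/top, top/left); $T_5$ carries a segment joining the left and right midpoints; $T_6$ carries a segment joining the bottom and top midpoints; $T_7,T_8$ are the two tiles carrying two disjoint arcs, each joining midpoints of adjacent sides; $T_9,T_{10}$ carry the horizontal and the vertical segment crossing once at the center, with the two possible choices of over/under information. Edge mosaics. An edge mosaic is a finite rectangular grid of edge tiles such that every endpoint of a curve on a tile coincides with an endpoint of a curve on the edge-adjacent tile (in particular no endpoints lie on the outer boundary of the grid). It is thus a link diagram, and it represents (is a mosaic for) the corresponding link. The edge tile number $t(L)$ is the minimum number of nonempty tiles (tiles other than $T_0$) in an edge mosaic representing $L$. Corner tiles. The pattern on each corner tile is the pattern on the corresponding edge tile rotated clockwise by $\pi/4$, with the curve endpoints now placed at corners of the square: $T_0$ is empty; $T_1,T_2,T_3,T_4$ carry a single arc joining the two left, the two bottom, the two right, the two top corners, respectively; $T_5$ carries a segment from upper-left to lower-right corner; $T_6$ carries a segment from lower-left to upper-right corner; $T_7,T_8$ are the two tiles carrying two disjoint arcs, each joining two adjacent corners; $T_9,T_{10}$ carry both diagonals crossing once at the center, with the two possible choices of over/under information. Corner mosaics. A corner mosaic is a finite rectangular grid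 of corner tiles such that every vertex of the grid is an endpoint of either no curve or exactly two curves on the tiles meeting at that vertex. It is thus a link diagram and represents the corresponding link. The corner tile number $t_C(L)$ is the minimum number of nonempty tiles in a corner mosaic representing $L$. Caps. In an edge mosaic, a cap is a pair of edge-adjacent tiles that, up to rotation, consists of a left tile carrying only an arc joining its right and bottom midpoints and a right tile carrying only an arc joining its left and bottom midpoints (so that together they form a $\cap$ shape). Let $\mathscr M^L$ be the set of edge mosaics for $L$ with exactly $t(L)$ nonempty tiles. Define $\operatorname{caps}(L)=\max\{\text{number of caps in } M \mid M\in\mathscr M^L\}$, where caps are counted so that any one tile contributes to at most one cap (i.e. the number of caps in $M$ is the maximum number of pairwise disjoint caps). For example, $\operatorname{caps}(\text{unknot})=2$. *)

theory Defs
  imports "HOL-Analysis.Analysis" "HOL-Library.Extended_Nat"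
begin

section \<open>Tame links in the 3-sphere\<close>

type_synonym point = "real \<times> real \<times> real"

abbreviation S3 :: "(point \<times> real) set"
  where "S3 \<equiv> sphere 0 1"

definition ambient_isotopic :: "(point \<times> real) set \<Rightarrow> (point \<times> real) set \<Rightarrow> bool"
  where "ambient_isotopic A B \<longleftrightarrow>
    (\<exists>h. homotopic_with_canon (\<lambda>f. \<exists>g. homeomorphism S3 S3 f g) S3 S3 id h \<and> h ` A = B)"

text \<open>Inverse stereographic projection from the north pole. It identifies Euclidean 3-space with
  the sphere minus a point.\<close>

definition to_S3 :: "point \<Rightarrow> point \<times> real"
  where "to_S3 p = ((2 / ((norm p)\<^sup>2 + 1)) *\<^sub>R p, ((norm p)\<^sup>2 - 1) / ((norm p)\<^sup>2 + 1))"

definition link :: "(point \<times> real) set \<Rightarrow> bool"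
  where "link L \<longleftrightarrow> L \<subseteq> S3 \<and> L \<noteq> {} \<and>
    (\<exists>\<C>. finite \<C> \<and> pairwise disjnt \<C> \<and> (\<forall>C\<in>\<C>. C homeomorphic sphere (0::complex) 1) \<and> L = \<Union>\<C>)"

definition polygonal :: "point set \<Rightarrow> bool"
  where "polygonal P \<longleftrightarrow> (\<exists>E. finite E \<and> P = (\<Union>(a, b)\<in>E. closed_segment a b))"

definition tame_link :: "(point \<times> real) set \<Rightarrow> bool"
  where "tame_link L \<longleftrightarrow> link L \<and> (\<exists>P. polygonal P \<and> ambient_isotopic (to_S3 ` P) L)"

section \<open>Tiles\<close>

datatype side = Left | Bottom | Right | Top

fun opposite :: "side \<Rightarrow> side" where
  "opposite Left = Right"
| "opposite Bottom = Top"
| "opposite Right = Left"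
| "opposite Top = Bottom"

datatype tile = T0 | T1 | T2 | T3 | T4 | T5 | T6 | T7 | T8 | T9 | T10

text \<open>The triple \<open>(s, s', h)\<close> is a curve from the midpoint of side \<open>s\<close> to the midpoint
  of side \<open>s'\<close> of an edge tile, whose middle point is lifted to height \<open>h\<close> above the plane
  of the diagram: at a crossing the over-strand has \<open>h = 1\<close> and the under-strand \<open>h = 0\<close>.\<close>

fun curves :: "tile \<Rightarrow> (side \<times> side \<times> real) set" where
  "curves T0 = {}"
| "curves T1 = {(Left, Bottom, 0)}"
| "curves T2 = {(Bottom, Right, 0)}"
| "curves T3 = {(Right, Top, 0)}"
| "curves T4 = {(Top, Left, 0)}"
| "curves T5 = {(Left, Right, 0)}"
| "curves T6 = {(Bottom, Top, 0)}"
| "curves T7 = {(Left, Bottom, 0), (Right, Top, 0)}"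
| "curves T8 = {(Bottom, Right, 0), (Top, Left, 0)}"
| "curves T9 = {(Left, Right, 1), (Bottom, Top, 0)}"
| "curves T10 = {(Left, Right, 0), (Bottom, Top, 1)}"

definition ends :: "tile \<Rightarrow> side set"
  where "ends t = (\<Union>(s, s', h)\<in>curves t. {s, s'})"

text \<open>The drawing of an edge tile in the unit square centred at the origin. The breakpoint
  \<open>p\<close> is the centre of the square if the sides are opposite. If they are adjacent, it lies
  strictly between the centre and the chord, so that the two arcs of a tile are disjoint, and
  the arcs of a corner tile meet the boundary of the square only in their endpoints.\<close>

fun midpt :: "side \<Rightarrow> point" where
  "midpt Left = (- 1 / 2, 0, 0)"
| "midpt Bottom = (0, - 1 / 2, 0)"
| "midpt Right = (1 / 2, 0, 0)"
| "midpt Top = (0, 1 / 2, 0)"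

definition draw :: "tile \<Rightarrow> point set"
  where "draw t = (\<Union>(s, s', h)\<in>curves t.
    let p = (1 / 4) *\<^sub>R (midpt s + midpt s') + (0, 0, h)
    in closed_segment (midpt s) p \<union> closed_segment p (midpt s'))"

text \<open>Clockwise rotation of the plane by \<open>\<pi> / 4\<close>, followed by scaling by \<open>sqrt 2\<close>, so
  that the midpoints of the sides of the unit square go to its corners.\<close>

definition turn :: "point \<Rightarrow> point"
  where "turn = (\<lambda>(x, y, z). (x + y, y - x, z))"

section \<open>Mosaics\<close>

text \<open>The cell \<open>(i, j)\<close> is the unit square \<open>[i, i + 1] \<times> [j, j + 1]\<close>, so \<open>i\<close>
  increases to the right and \<open>j\<close> upwards. Values of \<open>tile_at\<close> outside the grid are
  irrelevant.\<close>

record mosaic =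
  width :: nat
  height :: nat
  tile_at :: "int \<times> int \<Rightarrow> tile"

definition grid :: "mosaic \<Rightarrow> (int \<times> int) set"
  where "grid M = {0..<int (width M)} \<times> {0..<int (height M)}"

definition nonempty_tiles :: "mosaic \<Rightarrow> nat"
  where "nonempty_tiles M = card {c \<in> grid M. tile_at M c \<noteq> T0}"

definition centre :: "int \<times> int \<Rightarrow> point"
  where "centre = (\<lambda>(i, j). (of_int i + 1 / 2, of_int j + 1 / 2, 0))"

fun neighbour :: "side \<Rightarrow> int \<times> int \<Rightarrow> int \<times> int" where
  "neighbour Left (i, j) = (i - 1, j)"
| "neighbour Bottom (i, j) = (i, j - 1)"
| "neighbour Right (i, j) = (i + 1, j)"
| "neighbour Top (i, j) = (i, j + 1)"

definition edge_mosaic :: "mosaic \<Rightarrow> bool"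
  where "edge_mosaic M \<longleftrightarrow>
    (\<forall>c\<in>grid M. \<forall>s\<in>ends (tile_at M c).
       neighbour s c \<in> grid M \<and> opposite s \<in> ends (tile_at M (neighbour s c)))"

definition edge_link :: "mosaic \<Rightarrow> (point \<times> real) set"
  where "edge_link M = to_S3 ` (\<Union>c\<in>grid M. (+) (centre c) ` draw (tile_at M c))"

text \<open>The corner of a cell to which the midpoint of the given side is moved by \<open>turn\<close>.\<close>

fun corner :: "side \<Rightarrow> int \<times> int \<Rightarrow> int \<times> int" where
  "corner Left (i, j) = (i, j + 1)"
| "corner Bottom (i, j) = (i, j)"
| "corner Right (i, j) = (i + 1, j)"
| "corner Top (i, j) = (i + 1, j + 1)"

definition corner_mosaic :: "mosaic \<Rightarrow> bool"
  where "corner_mosaic M \<longleftrightarrow>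
    (\<forall>v \<in> {0..int (width M)} \<times> {0..int (height M)}.
       card {(c, s). c \<in> grid M \<and> s \<in> ends (tile_at M c) \<and> corner s c = v} \<in> {0, 2})"

definition corner_link :: "mosaic \<Rightarrow> (point \<times> real) set"
  where "corner_link M = to_S3 ` (\<Union>c\<in>grid M. (+) (centre c) ` turn ` draw (tile_at M c))"

section \<open>Tile numbers and caps\<close>

definition edge_mosaics :: "(point \<times> real) set \<Rightarrow> mosaic set"
  where "edge_mosaics L = {M. edge_mosaic M \<and> ambient_isotopic (edge_link M) L}"

definition corner_mosaics :: "(point \<times> real) set \<Rightarrow> mosaic set"
  where "corner_mosaics L = {M. corner_mosaic M \<and> ambient_isotopic (corner_link M) L}"

text \<open>Infima in \<^typ>\<open>enat\<close> of nonempty sets are minima. Every tame link has an edge mosaic and a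
  corner mosaic; an infimum over the empty set would be \<open>\<infinity>\<close>.\<close>

definition edge_tile_number :: "(point \<times> real) set \<Rightarrow> enat"
  where "edge_tile_number L = (INF M\<in>edge_mosaics L. enat (nonempty_tiles M))"

definition corner_tile_number :: "(point \<times> real) set \<Rightarrow> enat"
  where "corner_tile_number L = (INF M\<in>corner_mosaics L. enat (nonempty_tiles M))"

text \<open>The four disjuncts are the rotations \<open>\<inter>\<close>, \<open>\<subset>\<close>, \<open>\<union>\<close>, \<open>\<supset>\<close>
  of a cap.\<close>

definition is_cap :: "mosaic \<Rightarrow> int \<times> int \<Rightarrow> int \<times> int \<Rightarrow> bool"
  where "is_cap M c d \<longleftrightarrow> c \<in> grid M \<and> d \<in> grid M \<and>
    (d = neighbour Right c \<and> tile_at M c = T2 \<and> tile_at M d = T1 \<or>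
     d = neighbour Top c \<and> tile_at M c = T3 \<and> tile_at M d = T2 \<or>
     d = neighbour Right c \<and> tile_at M c = T3 \<and> tile_at M d = T4 \<or>
     d = neighbour Top c \<and> tile_at M c = T4 \<and> tile_at M d = T1)"

definition num_caps :: "mosaic \<Rightarrow> nat"
  where "num_caps M = Max {card \<K> | \<K>. \<K> \<subseteq> {{c, d} | c d. is_cap M c d} \<and> pairwise disjnt \<K>}"

definition minimal_edge_mosaics :: "(point \<times> real) set \<Rightarrow> mosaic set"
  where "minimal_edge_mosaics L =
    {M \<in> edge_mosaics L. enat (nonempty_tiles M) = edge_tile_number L}"

text \<open>The supremum is a maximum, since the number of caps is at most the number of nonempty tiles.\<close>

definition caps :: "(point \<times> real) set \<Rightarrow> enat"
  where "caps L = (SUP M\<in>minimal_edge_mosaics L. enat (num_caps M))"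

end

theory Submission
  imports Defs
begin

text \<open>
  Turn an edge mosaic clockwise by \<open>\<pi> / 4\<close>. The midpoints of the sides of a cell span a square, and
  this square becomes a corner tile. The squares of all cells fill only every other square of the turned
  grid; each remaining square lies around a vertex of the edge grid, and the diagram meets it in corners
  only. Thus every edge mosaic is a corner mosaic with the same number of nonempty tiles, in which the
  tiles of the vertices are empty. This room is used to save one tile for each cap.

  The arcs of a cap end at two opposite corners of the square around one vertex. Pulling the cap straight
  onto the diagonal of that square empties two tiles and fills one (\<open>cap_move\<close>). Disjoint caps at different
  vertices do not interfere. Two disjoint caps at the same vertex lie on opposite sides of it and form a
  circle of four tiles. Once the first of them has become a diagonal, one arc of the second one and the
  diagonal meet at a corner; pulling them off this corner into the square of the vertex leaves a single arc
  there, and again one tile is saved (\<open>fold_move\<close>). So every family of disjoint caps can be worked off one by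
  one (\<open>straighten_caps\<close>), and an edge mosaic with \<open>t\<close> nonempty tiles and \<open>k\<close> disjoint caps yields a
  corner mosaic for the same link with at most \<open>t - k\<close> nonempty tiles (\<open>corner_mosaic_saving_caps\<close>). This
  holds for all edge mosaics, in particular for those that are minimal and have the most caps.

  Both moves replace the graph of one function by the graph of another one with the same end points, in a
  suitable direction of the plane. The isotopy pushes points parallel to that direction
  (\<open>isotopic_push_graph\<close>), by an amount that does not depend on the height, so that only the projection of
  the rest of the diagram has to be kept away from the region between the graphs. Isotopies of space
  extend to the sphere by fixing the point at infinity (\<open>isotopicI\<close>).
\<close>

section \<open>Ambient isotopies of the sphere induced by isotopies of space\<close>

lemma ambient_isotopic_trans:
  assumes "ambient_isotopic A B" "ambient_isotopic B C"
  shows "ambient_isotopic A C"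
proof -
  let ?P = "\<lambda>f. \<exists>g. homeomorphism S3 S3 f g"
  obtain h k where h: "homotopic_with_canon ?P S3 S3 id h" "h ` A = B"
    and k: "homotopic_with_canon ?P S3 S3 id k" "k ` B = C"
    using assms by (auto simp: ambient_isotopic_def)
  obtain h' where hom: "homeomorphism S3 S3 h h'"
    using homotopic_with_imp_property[OF h(1)] by blast
  have "homotopic_with_canon ?P S3 S3 (id \<circ> h) (k \<circ> h)"
  proof (rule homotopic_with_compose_continuous_map_right[OF k(1)])
    show "continuous_map (top_of_set S3) (top_of_set S3) h"
      using homotopic_with_imp_continuous_maps[OF h(1)] by simp
    show "?P (j \<circ> h)" if "?P j" for j
      using that homeomorphism_compose[OF hom] by blast
  qed
  then have "homotopic_with_canon ?P S3 S3 id (k \<circ> h)"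
    using h(1) homotopic_with_trans by auto
  moreover have "(k \<circ> h) ` A = C"
    using h(2) k(2) by (metis image_comp)
  ultimately show ?thesis
    unfolding ambient_isotopic_def by blast
qed

lemma ambient_isotopic_sym:
  assumes "ambient_isotopic A B" "A \<subseteq> S3"
  shows "ambient_isotopic B A"
proof -
  let ?P = "\<lambda>f. \<exists>g. homeomorphism S3 S3 f g"
  obtain h where h: "homotopic_with_canon ?P S3 S3 id h" "h ` A = B"
    using assms(1) by (auto simp: ambient_isotopic_def)
  obtain h' where hom: "homeomorphism S3 S3 h h'"
    using homotopic_with_imp_property[OF h(1)] by blast
  have cont: "continuous_map (top_of_set S3) (top_of_set S3) h'"
    using hom by (auto simp: homeomorphism_def)
  have "homotopic_with_canon ?P S3 S3 (h \<circ> h') (id \<circ> h')"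
  proof (rule homotopic_with_compose_continuous_map_right[OF homotopic_with_symD[OF h(1)] cont])
    show "?P (j \<circ> h')" if "?P j" for j
      using that homeomorphism_compose[OF homeomorphism_symD[OF hom]] by blast
  qed
  moreover have "homotopic_with_canon ?P S3 S3 id (h \<circ> h')"
  proof (rule homotopic_with_equal)
    show "?P id"
      by (rule exI[of _ id]) (simp add: homeomorphism_def)
    show "?P (h \<circ> h')"
      using homeomorphism_compose[OF homeomorphism_symD[OF hom] hom] by blast
    show "id x = (h \<circ> h') x" if "x \<in> topspace (top_of_set S3)" for x
      using that hom by (simp add: homeomorphism_def)
  qed simp
  ultimately have "homotopic_with_canon ?P S3 S3 id h'"
    using homotopic_with_trans by fastforce
  moreover have "h' ` B = A"
    proof -
    have "h' (h x) = x" if "x \<in> A" for x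
      using hom assms(2) that by (auto simp: homeomorphism_def)
    then show ?thesis
      by (force simp: h(2)[symmetric])
  qed
  ultimately show ?thesis
    unfolding ambient_isotopic_def by blast
qed

text \<open>The inverse of \<^const>\<open>to_S3\<close> away from the north pole.\<close>

definition from_S3 :: "point \<times> real \<Rightarrow> point"
  where "from_S3 q = (1 / (1 - snd q)) *\<^sub>R fst q"

abbreviation pole :: "point \<times> real"
  where "pole \<equiv> (0, 1)"

lemma pole_in_S3: "pole \<in> S3"
  by (simp add: norm_Pair)

lemma norm_sq_plus_one_pos: "(norm (p::point))\<^sup>2 + 1 > 0"
  by (simp add: add_nonneg_pos)

lemma to_S3_in_S3: "to_S3 p \<in> S3"
proof -
  let ?n = "(norm p)\<^sup>2"
  have pos: "?n + 1 > 0" by (rule norm_sq_plus_one_pos)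
  have "(norm (to_S3 p))\<^sup>2 = (2 / (?n + 1))\<^sup>2 * ?n + ((?n - 1) / (?n + 1))\<^sup>2"
    by (simp add: to_S3_def norm_Pair power_mult_distrib power_divide)
  also have "\<dots> = (4 * ?n + (?n - 1)\<^sup>2) / (?n + 1)\<^sup>2"
    by (simp add: power_divide add_divide_distrib)
  also have "4 * ?n + (?n - 1)\<^sup>2 = (?n + 1)\<^sup>2"
    by (simp add: power2_eq_square algebra_simps)
  finally have "(norm (to_S3 p))\<^sup>2 = 1"
    using pos by simp
  then show ?thesis
    using norm_ge_zero[of "to_S3 p"] by (auto simp: power2_eq_1_iff simp del: norm_ge_zero)
qed

lemma to_S3_neq_pole: "to_S3 p \<noteq> pole"
  using norm_sq_plus_one_pos[of p] by (auto simp: to_S3_def)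

lemma from_S3_to_S3: "from_S3 (to_S3 p) = p"
proof -
  let ?n = "(norm p)\<^sup>2"
  have "1 - (?n - 1) / (?n + 1) = 2 / (?n + 1)"
    using norm_sq_plus_one_pos[of p] by (simp add: field_simps)
  then have "1 / (1 - (?n - 1) / (?n + 1)) * (2 / (?n + 1)) = 1"
    using norm_sq_plus_one_pos[of p] by simp
  then show ?thesis
    by (simp add: from_S3_def to_S3_def del: times_divide_eq_left times_divide_eq_right)
qed

lemma S3_snd_neq_1:
  assumes "q \<in> S3" "q \<noteq> pole"
  shows "snd q \<noteq> 1"
proof
  assume 1: "snd q = 1"
  have "(norm (fst q))\<^sup>2 + (snd q)\<^sup>2 = 1"
    using assms(1) by (cases q) (simp add: norm_Pair)
  then have "fst q = 0"
    using 1 by simp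
  then show False
    using 1 assms(2) by (simp add: prod_eq_iff)
qed

lemma to_S3_from_S3:
  assumes "q \<in> S3" "q \<noteq> pole"
  shows "to_S3 (from_S3 q) = q"
proof -
  obtain x s where q: "q = (x, s)" by (rule prod.exhaust)
  have eq: "(norm x)\<^sup>2 + s\<^sup>2 = 1"
    using assms(1) by (simp add: q norm_Pair)
  have ne: "1 - s \<noteq> 0"
    using S3_snd_neq_1[OF assms] by (simp add: q)
  have "(norm (from_S3 q))\<^sup>2 = (1 - s\<^sup>2) / (1 - s)\<^sup>2"
    using eq by (simp add: from_S3_def q power_divide)
  also have "\<dots> = ((1 + s) * (1 - s)) / ((1 - s) * (1 - s))"
    by (simp add: power2_eq_square algebra_simps)
  also have "\<dots> = (1 + s) / (1 - s)"
    using ne by (rule mult_divide_mult_cancel_right)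
  finally have n: "(norm (from_S3 q))\<^sup>2 = (1 + s) / (1 - s)" .
  have "(norm (from_S3 q))\<^sup>2 + 1 = 2 / (1 - s)" "(norm (from_S3 q))\<^sup>2 - 1 = 2 * s / (1 - s)"
    using ne unfolding n by (simp_all add: field_simps)
  then show ?thesis
    using ne unfolding to_S3_def by (simp add: from_S3_def q)
qed

lemma dist_pole: "dist (to_S3 p) pole = 2 / sqrt ((norm p)\<^sup>2 + 1)"
proof -
  let ?n = "(norm p)\<^sup>2"
  have pos: "?n + 1 > 0" by (rule norm_sq_plus_one_pos)
  have m: "(?n - 1) / (?n + 1) - 1 = - 2 / (?n + 1)"
    using pos by (simp add: field_simps)
  have "(dist (to_S3 p) pole)\<^sup>2 = (2 / (?n + 1))\<^sup>2 * ?n + ((?n - 1) / (?n + 1) - 1)\<^sup>2"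
    by (simp add: to_S3_def dist_norm norm_Pair power_mult_distrib power_divide)
  also have "\<dots> = (4 * ?n + 4) / (?n + 1)\<^sup>2"
    unfolding m by (simp add: power_divide add_divide_distrib)
  also have "\<dots> = (4 * (?n + 1)) / ((?n + 1) * (?n + 1))"
    by (simp add: power2_eq_square)
  also have "\<dots> = 4 / (?n + 1)"
    using pos by (intro mult_divide_mult_cancel_right) simp
  also have "\<dots> = (2 / sqrt (?n + 1))\<^sup>2"
    using pos by (simp add: power_divide)
  finally show ?thesis
    using pos by (simp add: power2_eq_iff_nonneg)
qed

lemma continuous_on_to_S3: "continuous_on A to_S3"
proof -
  have "(norm p)\<^sup>2 + 1 \<noteq> 0" for p :: point
    using norm_sq_plus_one_pos[of p] by linarith
  then show ?thesis
    unfolding to_S3_def by (intro continuous_intros) blast+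
qed

lemma continuous_on_from_S3: "continuous_on (S3 - {pole}) from_S3"
proof -
  have "1 - snd q \<noteq> 0" if "q \<in> S3 - {pole}" for q :: "point \<times> real"
    using S3_snd_neq_1[of q] that by auto
  then show ?thesis
    unfolding from_S3_def by (intro continuous_intros) blast+
qed

definition isotopic :: "point set \<Rightarrow> point set \<Rightarrow> bool"
  where "isotopic X Y \<longleftrightarrow> ambient_isotopic (to_S3 ` X) (to_S3 ` Y)"

lemma isotopic_trans: "isotopic X Y \<Longrightarrow> isotopic Y Z \<Longrightarrow> isotopic X Z"
  unfolding isotopic_def by (rule ambient_isotopic_trans)

lemma isotopic_sym: "isotopic X Y \<Longrightarrow> isotopic Y X"
  unfolding isotopic_def by (rule ambient_isotopic_sym) (use to_S3_in_S3 in \<open>auto simp del: mem_sphere\<close>)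

text \<open>A homotopy through bijections of space extends to the sphere by fixing the north pole. It is
  continuous there because points far out stay far out, uniformly in time; and since the sphere is
  compact, the inverses are continuous automatically.\<close>

lemma isotopicI:
  fixes H :: "real \<times> point \<Rightarrow> point"
  assumes cont: "continuous_on ({0..1} \<times> UNIV) H"
    and bij: "\<And>t. t \<in> {0..1} \<Longrightarrow> bij (\<lambda>p. H (t, p))"
    and proper: "\<And>B. \<exists>R. \<forall>t\<in>{0..1}. \<forall>p. R \<le> norm p \<longrightarrow> B \<le> norm (H (t, p))"
    and H0: "\<And>p. H (0, p) = p"
  shows "isotopic X ((\<lambda>p. H (1, p)) ` X)"
proof -
  let ?P = "\<lambda>f. \<exists>g. homeomorphism S3 S3 f g"
  define K where "K = (\<lambda>(t, q). if q \<in> S3 - {pole} then to_S3 (H (t, from_S3 q)) else q)"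
  have K_pole: "K (t, pole) = pole" for t
    by (simp add: K_def)
  have K_to: "K (t, to_S3 p) = to_S3 (H (t, p))" for t p
    using to_S3_in_S3[of p] to_S3_neq_pole[of p] by (simp add: K_def from_S3_to_S3)
  have S3_cases: "q = pole \<or> (\<exists>p. q = to_S3 p)" if "q \<in> S3" for q
    using to_S3_from_S3[OF that] by metis
  have contK: "continuous_on ({0..1} \<times> S3) K"
    unfolding continuous_on_eq_continuous_within
  proof (intro ballI)
    fix z :: "real \<times> point \<times> real"
    assume z: "z \<in> {0..1} \<times> S3"
    obtain t q where tq: "z = (t, q)" by (rule prod.exhaust)
    have q: "q \<in> S3" and t: "t \<in> {0..1}" using z by (auto simp: tq)
    show "continuous (at z within {0..1} \<times> S3) K"
    proof (cases "q = pole")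
      case False
      let ?D = "{0..1} \<times> (S3 - {pole})"
      have "continuous_on ?D (\<lambda>z. to_S3 (H (fst z, from_S3 (snd z))))"
        by (intro continuous_on_compose2[OF continuous_on_to_S3[of UNIV]]
              continuous_on_compose2[OF cont] continuous_intros
              continuous_on_compose2[OF continuous_on_from_S3]) auto
      then have "continuous_on ?D K"
        by (rule continuous_on_eq) (simp add: K_def split_beta mem_Times_iff)
      then have "continuous (at z within ?D) K"
        using t q False by (auto simp: continuous_on_eq_continuous_within tq)
      moreover have "at z within ?D = at z within {0..1} \<times> S3"
        by (rule at_within_nhd[of _ "UNIV \<times> (- {pole})"]) (use False in \<open>auto simp: tq intro!: open_Times\<close>)
      ultimately show ?thesis by simp
    next
      case True
      show ?thesis
        unfolding continuous_within_eps_delta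
      proof (intro allI impI)
        fix e :: real assume e: "e > 0"
        obtain R where R: "\<And>t p. t \<in> {0..1} \<Longrightarrow> R \<le> norm p \<Longrightarrow> 2 / e \<le> norm (H (t, p))"
          using proper[of "2 / e"] by blast
        define r where "r = max R 0"
        have "dist (K z') (K z) < e"
          if z': "z' \<in> {0..1} \<times> S3" "dist z' z < 2 / (r + 1)" for z'
        proof -
          obtain t' q' where tq': "z' = (t', q')" by (rule prod.exhaust)
          have t': "t' \<in> {0..1}" and q': "q' \<in> S3" using z' by (auto simp: tq')
          consider "q' = pole" | p where "q' = to_S3 p"
            using S3_cases[OF q'] by blast
          then show ?thesis
          proof cases
            case 1
            then show ?thesis using e True K_pole by (simp add: tq tq')
          next
            case 2
            have "dist (to_S3 p) pole < 2 / (r + 1)"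
              using z'(2) dist_snd_le[of z' z] by (simp add: tq tq' True 2)
            then have "2 / sqrt ((norm p)\<^sup>2 + 1) < 2 / (r + 1)"
              by (simp add: dist_pole)
            then have "r + 1 < sqrt ((norm p)\<^sup>2 + 1)"
              using norm_sq_plus_one_pos[of p] by (simp add: field_simps r_def)
            also have "\<dots> \<le> norm p + 1"
              by (rule real_le_lsqrt) (auto simp: power2_eq_square algebra_simps)
            finally have "2 / e \<le> norm (H (t', p))"
              using R[OF t', of p] by (simp add: r_def)
            then have "2 / e < sqrt ((norm (H (t', p)))\<^sup>2 + 1)"
              using real_sqrt_less_mono[of "(norm (H (t', p)))\<^sup>2" "(norm (H (t', p)))\<^sup>2 + 1"] by simp
            then have "2 / sqrt ((norm (H (t', p)))\<^sup>2 + 1) < e"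
              using e norm_sq_plus_one_pos[of "H (t', p)"] by (simp add: field_simps)
            then show ?thesis
              using K_pole K_to by (simp add: tq tq' True 2 dist_pole)
          qed
        qed
        moreover have "2 / (r + 1) > 0"
          by (simp add: r_def add_nonneg_pos)
        ultimately show "\<exists>d>0. \<forall>z'\<in>{0..1} \<times> S3. dist z' z < d \<longrightarrow> dist (K z') (K z) < e"
          by blast
      qed
    qed
  qed
  have K_S3: "K (t, q) \<in> S3" if "q \<in> S3" for t q
    using S3_cases[OF that] K_pole K_to to_S3_in_S3 pole_in_S3 by metis
  have homeo: "?P (\<lambda>q. K (t, q))" if t: "t \<in> {0..1}" for t
  proof (rule homeomorphism_compact)
    show "compact S3" by simp
    show "continuous_on S3 (\<lambda>q. K (t, q))"
      by (rule continuous_on_compose2[OF contK]) (use t in \<open>auto intro!: continuous_intros\<close>)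
    show "(\<lambda>q. K (t, q)) ` S3 = S3"
    proof
      show "(\<lambda>q. K (t, q)) ` S3 \<subseteq> S3" using K_S3 by blast
      show "S3 \<subseteq> (\<lambda>q. K (t, q)) ` S3"
      proof
        fix q assume "q \<in> S3"
        then consider "q = pole" | p where "q = to_S3 p" using S3_cases by blast
        then show "q \<in> (\<lambda>q. K (t, q)) ` S3"
        proof cases
          case 1
          then show ?thesis using K_pole[of t] pole_in_S3 by (metis imageI)
        next
          case 2
          obtain p' where "p = H (t, p')"
            using bij[OF t] by (metis bij_pointE)
          then show ?thesis using K_to[of t p'] to_S3_in_S3[of p'] 2 by (metis imageI)
        qed
      qed
    qed
    show "inj_on (\<lambda>q. K (t, q)) S3"
    proof (rule inj_onI)
      fix q r assume "q \<in> S3" "r \<in> S3" and eq: "K (t, q) = K (t, r)"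
      then show "q = r"
        using S3_cases[of q] S3_cases[of r] bij[OF t] K_pole K_to to_S3_neq_pole from_S3_to_S3
        by (metis (no_types, lifting) bij_pointE)
    qed
  qed
  have "homotopic_with_canon ?P S3 S3 id (\<lambda>q. K (1, q))"
    unfolding homotopic_with_def
  proof (rule exI[of _ K], intro conjI ballI allI)
    show "continuous_map (prod_topology (top_of_set {0..1}) (top_of_set S3)) (top_of_set S3) K"
      using contK K_S3 by (auto simp: continuous_map_in_subtopology)
    show "K (0, q) = id q" for q
      using to_S3_from_S3 by (simp add: K_def H0)
    show "?P (\<lambda>q. K (t, q))" if "t \<in> {0..1}" for t
      using homeo[OF that] .
  qed simp
  moreover have "(\<lambda>q. K (1, q)) ` (to_S3 ` X) = to_S3 ` ((\<lambda>p. H (1, p)) ` X)"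
    by (simp add: image_image K_to)
  ultimately show ?thesis
    unfolding isotopic_def ambient_isotopic_def by blast
qed

lemma isotopic_translate: "isotopic X ((+) a ` X)"
proof -
  have "isotopic X ((\<lambda>p. (\<lambda>(t, p). p + t *\<^sub>R a) (1, p)) ` X)"
  proof (rule isotopicI)
    show "continuous_on ({0..1} \<times> UNIV) (\<lambda>(t, p). p + t *\<^sub>R a)"
      unfolding case_prod_beta by (intro continuous_intros)
    show "bij (\<lambda>p. (\<lambda>(t, p). p + t *\<^sub>R a) (t, p))" for t
      by (rule bij_betwI[of _ _ _ "\<lambda>p. p - t *\<^sub>R a"]) auto
    show "\<exists>R. \<forall>t\<in>{0..1}. \<forall>p. R \<le> norm p \<longrightarrow> B \<le> norm ((\<lambda>(t, p). p + t *\<^sub>R a) (t, p))" for B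
    proof (rule exI[of _ "B + norm a"], intro ballI allI impI)
      fix t :: real and p :: point assume t: "t \<in> {0..1}" and p: "B + norm a \<le> norm p"
      have "norm (t *\<^sub>R a) \<le> norm a"
        using t by (simp add: mult_left_le_one_le)
      then show "B \<le> norm ((\<lambda>(t, p). p + t *\<^sub>R a) (t, p))"
        using p norm_triangle_ineq4[of "p + t *\<^sub>R a" "t *\<^sub>R a"] by simp
    qed
  qed simp
  then show ?thesis by (simp add: add.commute[of a] image_def)
qed

text \<open>Multiplication by the complex number \<open>a + b \<i>\<close> in the plane of the diagram.\<close>

definition spiral :: "real \<Rightarrow> real \<Rightarrow> point \<Rightarrow> point"
  where "spiral a b = (\<lambda>(x, y, z). (a * x - b * y, b * x + a * y, z))"

lemma spiral_spiral: "spiral a b (spiral c d p) = spiral (a * c - b * d) (a * d + b * c) p"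
  by (cases p) (simp add: spiral_def algebra_simps)

lemma spiral_1_0: "spiral 1 0 p = p"
  by (cases p) (simp add: spiral_def)

text \<open>The segment from \<open>1\<close> to \<open>a + b \<i>\<close> avoids \<open>0\<close>, so multiplication by its points is an isotopy.\<close>

lemma isotopic_spiral:
  assumes "b \<noteq> 0"
  shows "isotopic X (spiral a b ` X)"
proof -
  define A where "A t = 1 - t + t * a" for t
  define N where "N t = (A t)\<^sup>2 + (t * b)\<^sup>2" for t
  have contA: "continuous_on S A" for S
    unfolding A_def by (intro continuous_intros)
  have N_pos: "N t > 0" if "t \<in> {0..1}" for t
  proof (cases "t = 0")
    case False
    then show ?thesis using assms by (simp add: N_def add_nonneg_pos)
  qed (simp add: N_def A_def)
  have "continuous_on {0..1} N"
    unfolding N_def by (intro continuous_intros contA)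
  then obtain t0 where t0: "t0 \<in> {0..1}" "\<And>t. t \<in> {0..1} \<Longrightarrow> N t0 \<le> N t"
    using continuous_attains_inf[of "{0..1::real}" N] by auto
  define m where "m = min 1 (N t0)"
  have m: "0 < m" "m \<le> 1" "\<And>t. t \<in> {0..1} \<Longrightarrow> m \<le> N t"
    using N_pos[OF t0(1)] t0(2) by (auto simp: m_def min_le_iff_disj)
  define H where "H = (\<lambda>(t, p). spiral (A t) (t * b) p)"
  have grow: "m * (norm p)\<^sup>2 \<le> (norm (H (t, p)))\<^sup>2" if t: "t \<in> {0..1}" for t p
  proof -
    obtain x y z where p: "p = (x, y, z)" by (metis prod_cases3)
    have "(norm (H (t, p)))\<^sup>2 = N t * (x\<^sup>2 + y\<^sup>2) + z\<^sup>2"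
      by (simp add: H_def p spiral_def norm_Pair N_def) (simp add: power2_eq_square algebra_simps)
    moreover have "m * (x\<^sup>2 + y\<^sup>2) \<le> N t * (x\<^sup>2 + y\<^sup>2)"
      using m(3)[OF t] by (intro mult_right_mono) auto
    moreover have "m * z\<^sup>2 \<le> z\<^sup>2"
      using m(1,2) by (simp add: mult_left_le_one_le)
    ultimately show ?thesis
      by (simp add: p norm_Pair algebra_simps)
  qed
  have "isotopic X ((\<lambda>p. H (1, p)) ` X)"
  proof (rule isotopicI)
    show "continuous_on ({0..1} \<times> UNIV) H"
      unfolding H_def spiral_def case_prod_beta
      by (intro continuous_intros continuous_on_compose2[OF contA[of UNIV]]) auto
    show "bij (\<lambda>p. H (t, p))" if t: "t \<in> {0..1}" for t
    proof (rule bij_betwI[of _ _ _ "spiral (A t / N t) (- (t * b) / N t)"])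
      have N: "A t / N t * A t + t * b / N t * (t * b) = 1"
      proof -
        have "A t / N t * A t + t * b / N t * (t * b) = N t / N t"
          by (simp only: N_def power2_eq_square add_divide_distrib times_divide_eq_left)
        then show ?thesis using N_pos[OF t] by simp
      qed
      show "spiral (A t / N t) (- (t * b) / N t) (H (t, p)) = p" for p
        using N by (simp add: H_def spiral_spiral spiral_1_0)
      show "H (t, spiral (A t / N t) (- (t * b) / N t) p) = p" for p
        using N by (simp add: H_def spiral_spiral spiral_1_0 mult.commute)
    qed auto
    show "\<exists>R. \<forall>t\<in>{0..1}. \<forall>p. R \<le> norm p \<longrightarrow> B \<le> norm (H (t, p))" for B
    proof (rule exI[of _ "\<bar>B\<bar> / sqrt m"], intro ballI allI impI)
      fix t :: real and p :: point assume t: "t \<in> {0..1}" and p: "\<bar>B\<bar> / sqrt m \<le> norm p"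
      have "\<bar>B\<bar> \<le> sqrt m * norm p"
        using p m(1) by (simp add: field_simps)
      then have "B\<^sup>2 \<le> (sqrt m * norm p)\<^sup>2"
        using power_mono[of "\<bar>B\<bar>" "sqrt m * norm p" 2] by simp
      also have "\<dots> = m * (norm p)\<^sup>2"
        using m(1) by (simp add: power_mult_distrib)
      finally have "B\<^sup>2 \<le> (norm (H (t, p)))\<^sup>2"
        using grow[OF t, of p] by simp
      then show "B \<le> norm (H (t, p))"
        by (rule power2_le_imp_le) simp
    qed
    show "H (0, p) = p" for p
      by (cases p) (simp add: H_def spiral_def A_def)
  qed
  then show ?thesis
    by (simp add: H_def A_def)
qed

section \<open>Pushing a graph along parallel lines\<close>

text \<open>The displacement \<open>\<delta>\<close> grows along \<open>e\<close> at a rate of at most \<open>A < 1\<close>, so the push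
  cannot let two points of a line parallel to \<open>e\<close> change their order.\<close>

lemma isotopic_push:
  fixes \<delta> :: "point \<Rightarrow> real" and e :: point
  assumes cont: "continuous_on UNIV \<delta>"
    and bounds: "\<And>p. 0 \<le> \<delta> p" "\<And>p. \<delta> p \<le> C"
    and slope: "\<And>p r. r > 0 \<Longrightarrow> \<delta> (p + r *\<^sub>R e) - \<delta> p \<le> A * r"
    and A: "0 \<le> A" "A < 1"
  shows "isotopic X ((\<lambda>p. p - \<delta> p *\<^sub>R e) ` X)"
proof -
  define H where "H = (\<lambda>(t, p). p - (t * \<delta> p) *\<^sub>R e)"
  have no_collapse: "r \<le> 0"
    if t: "t \<in> {0..1}" and r: "r = t * \<delta> (p + r *\<^sub>R e) - t * \<delta> p" for t r p
  proof (rule ccontr)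
    assume "\<not> r \<le> 0"
    then have pos: "r > 0" by simp
    have "r = t * (\<delta> (p + r *\<^sub>R e) - \<delta> p)"
      using r by (simp add: algebra_simps)
    also have "\<dots> \<le> t * (A * r)"
      using slope[OF pos] t by (intro mult_left_mono) auto
    also have "\<dots> \<le> 1 * (A * r)"
      using t A pos by (intro mult_right_mono) auto
    also have "\<dots> < r" using A pos by simp
    finally show False by simp
  qed
  have inj: "p = q" if t: "t \<in> {0..1}" and eq: "H (t, p) = H (t, q)" for t p q
  proof -
    define r where "r = t * \<delta> q - t * \<delta> p"
    have q: "q = p + r *\<^sub>R e"
      using eq by (simp add: H_def r_def algebra_simps)
    then have p: "p = q + (- r) *\<^sub>R e" by simp
    have "r \<le> 0"
      by (rule no_collapse[OF t, of _ p]) (subst q[symmetric], rule r_def)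
    moreover have "- r \<le> 0"
      by (rule no_collapse[OF t, of _ q]) (subst p[symmetric], simp add: r_def)
    ultimately show ?thesis using q by simp
  qed
  have surj: "\<exists>p. H (t, p) = q" if t: "t \<in> {0..1}" for t q
  proof -
    have contr: "continuous_on {0..C} (\<lambda>r. r - t * \<delta> (q + r *\<^sub>R e))"
      by (intro continuous_intros continuous_on_compose2[OF cont]) auto
    have "0 \<le> C" using bounds order_trans by blast
    have "t * \<delta> (q + C *\<^sub>R e) \<le> 1 * C"
      using t bounds by (intro mult_mono) auto
    moreover have "0 - t * \<delta> (q + 0 *\<^sub>R e) \<le> 0"
      using t bounds by simp
    ultimately obtain r where "r - t * \<delta> (q + r *\<^sub>R e) = 0"
      using IVT'[OF _ _ \<open>0 \<le> C\<close> contr, of 0] by auto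
    then have "H (t, q + r *\<^sub>R e) = q"
      by (simp add: H_def)
    then show ?thesis by blast
  qed
  have "isotopic X ((\<lambda>p. H (1, p)) ` X)"
  proof (rule isotopicI)
    show "continuous_on ({0..1} \<times> UNIV) H"
      unfolding H_def case_prod_beta
      by (intro continuous_intros continuous_on_compose2[OF cont]) auto
    show "bij (\<lambda>p. H (t, p))" if "t \<in> {0..1}" for t
      unfolding bij_def inj_def surj_def using inj[OF that] surj[OF that] by metis
    show "\<exists>R. \<forall>t\<in>{0..1}. \<forall>p. R \<le> norm p \<longrightarrow> B \<le> norm (H (t, p))" for B
    proof (rule exI[of _ "B + C * norm e"], intro ballI allI impI)
      fix t :: real and p :: point assume t: "t \<in> {0..1}" and p: "B + C * norm e \<le> norm p"
      have "t * \<delta> p \<le> 1 * C" using t bounds by (intro mult_mono) auto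
      then have "norm ((t * \<delta> p) *\<^sub>R e) \<le> C * norm e"
        using t bounds by (simp add: mult_right_mono)
      then show "B \<le> norm (H (t, p))"
        using p norm_triangle_ineq2[of p "(t * \<delta> p) *\<^sub>R e"] by (simp add: H_def)
    qed
    show "H (0, p) = p" for p
      by (simp add: H_def)
  qed
  then show ?thesis
    by (simp add: H_def)
qed

text \<open>On each line parallel to \<open>e\<close> the coordinate \<open>\<sigma>\<close> is constant and \<open>\<eta>\<close> measures the position. The
  displacement starts at \<open>lo\<close> and grows at rate \<open>A\<close>, which by \<open>room\<close> is fast enough to reach \<open>f - g\<close> at the
  graph of \<open>f\<close>; beyond that graph it decreases at rate \<open>B\<close>. As the maximum of \<open>0\<close> and a minimum of
  continuous functions it is continuous even at the end points of the interval where \<open>g < f\<close>, at which the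
  region that moves shrinks to a point.\<close>

lemma isotopic_push_graph:
  fixes \<sigma> \<eta> :: "point \<Rightarrow> real" and f g lo :: "real \<Rightarrow> real" and e :: point
  assumes cont: "continuous_on UNIV \<sigma>" "continuous_on UNIV \<eta>"
      "continuous_on UNIV f" "continuous_on UNIV g" "continuous_on UNIV lo"
    and \<sigma>: "\<And>p r. \<sigma> (p + r *\<^sub>R e) = \<sigma> p"
    and \<eta>: "\<And>p r. \<eta> (p + r *\<^sub>R e) = \<eta> p + r"
    and Z: "\<And>p r. p + r *\<^sub>R e \<in> Z \<longleftrightarrow> p \<in> Z"
    and A: "0 \<le> A" "A < 1" and B: "0 \<le> B"
    and room: "\<And>s. g s \<le> f s \<Longrightarrow> f s - g s \<le> A * (f s - lo s)"
    and bounded: "\<And>s. f s - g s \<le> C" "0 \<le> C"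
    and Zfg: "\<And>p. p \<in> Z \<Longrightarrow> g (\<sigma> p) \<le> f (\<sigma> p)"
    and avoid: "\<And>p. p \<in> R \<Longrightarrow> g (\<sigma> p) < f (\<sigma> p) \<Longrightarrow> lo (\<sigma> p) < \<eta> p \<Longrightarrow>
        B * (\<eta> p - f (\<sigma> p)) < f (\<sigma> p) - g (\<sigma> p) \<Longrightarrow> False"
  shows "isotopic (R \<union> {p \<in> Z. \<eta> p = f (\<sigma> p)}) (R \<union> {p \<in> Z. \<eta> p = g (\<sigma> p)})"
proof -
  define \<phi> where "\<phi> p = f (\<sigma> p) - g (\<sigma> p)" for p
  define \<alpha> where "\<alpha> p = A * (\<eta> p - lo (\<sigma> p))" for p
  define \<beta> where "\<beta> p = \<phi> p - B * (\<eta> p - f (\<sigma> p))" for p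
  define \<delta> where "\<delta> p = max 0 (min (\<phi> p) (min (\<alpha> p) (\<beta> p)))" for p
  have cont\<phi>: "continuous_on UNIV \<phi>" and cont\<alpha>: "continuous_on UNIV \<alpha>"
    unfolding \<phi>_def \<alpha>_def
    by (intro continuous_intros cont continuous_on_compose2[OF cont(3)]
          continuous_on_compose2[OF cont(4)] continuous_on_compose2[OF cont(5)]; simp)+
  have cont\<beta>: "continuous_on UNIV \<beta>"
    unfolding \<beta>_def
    by (intro continuous_intros cont cont\<phi> continuous_on_compose2[OF cont(3)]) simp_all
  have "continuous_on UNIV \<delta>"
    unfolding \<delta>_def by (intro continuous_intros cont\<phi> cont\<alpha> cont\<beta>)
  moreover have "0 \<le> \<delta> p" "\<delta> p \<le> C" for p
    using bounded by (auto simp: \<delta>_def \<phi>_def min_le_iff_disj)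
  moreover have "\<delta> (p + r *\<^sub>R e) - \<delta> p \<le> A * r" if "r > 0" for p r
  proof -
    have "\<phi> (p + r *\<^sub>R e) = \<phi> p" "\<alpha> (p + r *\<^sub>R e) = \<alpha> p + A * r"
      "\<beta> (p + r *\<^sub>R e) = \<beta> p - B * r"
      by (simp_all add: \<phi>_def \<alpha>_def \<beta>_def \<sigma> \<eta> algebra_simps)
    moreover have "0 \<le> A * r" "0 \<le> B * r"
      using A B that by simp_all
    ultimately show ?thesis
      by (simp add: \<delta>_def)
  qed
  ultimately have push: "isotopic X ((\<lambda>p. p - \<delta> p *\<^sub>R e) ` X)" for X
    using A by (rule isotopic_push)
  have R: "(\<lambda>p. p - \<delta> p *\<^sub>R e) ` R = R"
  proof -
    have "\<delta> p = 0" if "p \<in> R" for p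
    proof (rule ccontr)
      assume "\<delta> p \<noteq> 0"
      then have "0 < \<phi> p" "0 < \<alpha> p" "0 < \<beta> p"
        by (auto simp: \<delta>_def max_def min_def split: if_splits)
      then show False
        using avoid[OF that] A(1) by (auto simp: \<phi>_def \<alpha>_def \<beta>_def zero_less_mult_iff)
    qed
    then show ?thesis by force
  qed
  have graph: "(\<lambda>p. p - \<delta> p *\<^sub>R e) ` {p \<in> Z. \<eta> p = f (\<sigma> p)} = {p \<in> Z. \<eta> p = g (\<sigma> p)}"
  proof -
    have Z': "p - r *\<^sub>R e \<in> Z \<longleftrightarrow> p \<in> Z" and \<sigma>': "\<sigma> (p - r *\<^sub>R e) = \<sigma> p"
      and \<eta>': "\<eta> (p - r *\<^sub>R e) = \<eta> p - r" for p r
      using Z[of p "- r"] \<sigma>[of p "- r"] \<eta>[of p "- r"] by simp_all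
    have on_graph: "\<delta> p = f (\<sigma> p) - g (\<sigma> p)" if "p \<in> Z" "\<eta> p = f (\<sigma> p)" for p
      using Zfg[OF that(1)] room[of "\<sigma> p"] by (simp add: \<delta>_def \<phi>_def \<alpha>_def \<beta>_def that(2))
    show ?thesis
    proof (intro equalityI subsetI)
      fix q assume "q \<in> (\<lambda>p. p - \<delta> p *\<^sub>R e) ` {p \<in> Z. \<eta> p = f (\<sigma> p)}"
      then show "q \<in> {p \<in> Z. \<eta> p = g (\<sigma> p)}"
        using on_graph by (auto simp: Z' \<sigma>' \<eta>')
    next
      fix q assume q: "q \<in> {p \<in> Z. \<eta> p = g (\<sigma> p)}"
      define p where "p = q + (f (\<sigma> q) - g (\<sigma> q)) *\<^sub>R e"
      have p: "p \<in> Z" "\<sigma> p = \<sigma> q" "\<eta> p = f (\<sigma> p)"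
        using q by (simp_all add: p_def Z \<sigma> \<eta>)
      have "\<delta> p = f (\<sigma> q) - g (\<sigma> q)"
        using on_graph p by simp
      then have "q = p - \<delta> p *\<^sub>R e"
        by (simp only: p_def add_diff_cancel)
      then show "q \<in> (\<lambda>p. p - \<delta> p *\<^sub>R e) ` {p \<in> Z. \<eta> p = f (\<sigma> p)}"
        using p by blast
    qed
  qed
  show ?thesis
    using push[of "R \<union> {p \<in> Z. \<eta> p = f (\<sigma> p)}"] by (simp only: image_Un R graph)
qed

section \<open>Diagrams on the common lattice of cells and vertices\<close>

type_synonym diagram = "int \<times> int \<Rightarrow> tile"

text \<open>Cells and vertices of an edge grid together form one square lattice, in the coordinates of the turned
  grid. The picture is drawn before turning, so that the site \<open>(a, b)\<close> has integer coordinates if it is a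
  cell, where \<open>a + b\<close> is even, and half-integer ones if it is a vertex.\<close>

definition site :: "int \<times> int \<Rightarrow> point"
  where "site = (\<lambda>(a, b). ((of_int a - of_int b) / 2, (of_int a + of_int b) / 2, 0))"

definition picture :: "diagram \<Rightarrow> point set"
  where "picture D = (\<Union>c. (+) (site c) ` draw (D c))"

text \<open>The tiles that meet in the corner \<open>(a, b)\<close> of the turned grid have it on four different sides, because
  each side of an edge tile is turned into one corner of a corner tile.\<close>

definition degree :: "diagram \<Rightarrow> int \<times> int \<Rightarrow> nat"
  where "degree D = (\<lambda>(a, b).
    of_bool (Left \<in> ends (D (a, b - 1))) + of_bool (Bottom \<in> ends (D (a, b))) +
    of_bool (Right \<in> ends (D (a - 1, b))) + of_bool (Top \<in> ends (D (a - 1, b - 1))))"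

definition matched :: "diagram \<Rightarrow> bool"
  where "matched D \<longleftrightarrow> (\<forall>V. degree D V \<in> {0, 2})"

definition moves_to :: "diagram \<Rightarrow> diagram \<Rightarrow> bool"
  where "moves_to D D' \<longleftrightarrow> matched D' \<and> isotopic (picture D) (picture D')"

lemma ends_simps [simp]:
  "ends T0 = {}" "ends T1 = {Left, Bottom}" "ends T2 = {Bottom, Right}" "ends T3 = {Right, Top}"
  "ends T4 = {Top, Left}" "ends T5 = {Left, Right}" "ends T6 = {Bottom, Top}"
  "ends T7 = {Left, Bottom, Right, Top}" "ends T8 = {Bottom, Right, Top, Left}"
  "ends T9 = {Left, Right, Bottom, Top}" "ends T10 = {Left, Right, Bottom, Top}"
  by (auto simp: ends_def)

section \<open>Where the tiles are drawn\<close>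

lemma mem_translate: "(x, y, z) \<in> (+) (a, b, c) ` S \<longleftrightarrow> (x - a, y - b, z - c) \<in> S"
  for a b c :: real
  by (force simp: image_iff intro!: bexI[of _ "(x - a, y - b, z - c)"])

lemma mem_draw_cases:
  assumes "p \<in> draw t"
  obtains s s' h q where "(s, s', h) \<in> curves t" "q = (1 / 4) *\<^sub>R (midpt s + midpt s') + (0, 0, h)"
    "p \<in> closed_segment (midpt s) q \<or> p \<in> closed_segment q (midpt s')"
  using assms unfolding draw_def Let_def by (auto intro: that simp del: scaleR_Pair add_Pair)

lemma draw_subset_convex:
  assumes "convex S" "\<And>s. s \<in> ends t \<Longrightarrow> midpt s \<in> S"
    and "\<And>s s' h. (s, s', h) \<in> curves t \<Longrightarrow> (1 / 4) *\<^sub>R (midpt s + midpt s') + (0, 0, h) \<in> S"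
  shows "draw t \<subseteq> S"
proof
  fix p assume "p \<in> draw t"
  then obtain s s' h q where c: "(s, s', h) \<in> curves t"
    and q: "q = (1 / 4) *\<^sub>R (midpt s + midpt s') + (0, 0, h)"
    and p: "p \<in> closed_segment (midpt s) q \<or> p \<in> closed_segment q (midpt s')"
    by (rule mem_draw_cases)
  have "s \<in> ends t" "s' \<in> ends t"
    using c by (force simp: ends_def)+
  then have "midpt s \<in> S" "midpt s' \<in> S" "q \<in> S"
    using assms(2,3) c q by auto
  then show "p \<in> S"
    using p assms(1) closed_segment_subset by blast
qed

lemma convex_planar_halfspace: "convex {(x, y, z :: real). a * x + b * y \<le> (c :: real)}"
proof -
  have "{(x, y, z :: real). a * x + b * y \<le> c} = {p. inner (a, b, 0) p \<le> c}"
    by auto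
  then show ?thesis by (simp add: convex_halfspace_le)
qed

text \<open>A breakpoint lies halfway between the mean of the two ends and the centre, possibly lifted. So a vertical
  halfspace that contains the ends and the centre contains the whole drawing.\<close>

lemma draw_in_halfspace:
  assumes "\<And>s. s \<in> ends t \<Longrightarrow> a * fst (midpt s) + b * fst (snd (midpt s)) \<le> c" "0 \<le> c"
    and "(x, y, z) \<in> draw t"
  shows "a * x + b * y \<le> c"
proof -
  let ?S = "{(x, y, z :: real). a * x + b * y \<le> c}"
  have S: "p \<in> ?S \<longleftrightarrow> a * fst p + b * fst (snd p) \<le> c" for p
    by (auto simp: split_beta)
  have "draw t \<subseteq> ?S"
  proof (rule draw_subset_convex)
    fix s s' h assume "(s, s', h) \<in> curves t"
    then have "s \<in> ends t" "s' \<in> ends t"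
      by (force simp: ends_def)+
    then have "a * fst (midpt s) + b * fst (snd (midpt s)) \<le> c"
      "a * fst (midpt s') + b * fst (snd (midpt s')) \<le> c"
      using assms(1) by auto
    then show "(1 / 4) *\<^sub>R (midpt s + midpt s') + (0, 0, h) \<in> ?S"
      unfolding S using assms(2) by (simp add: algebra_simps)
  qed (use assms(1) in \<open>auto simp: S convex_planar_halfspace simp del: mem_Collect_eq\<close>)
  then show ?thesis using assms(3) by auto
qed

lemma draw_in_diamond:
  assumes "(x, y, z) \<in> draw t"
  shows "\<bar>x\<bar> + \<bar>y\<bar> \<le> 1 / 2"
proof -
  have "a * fst (midpt s) + b * fst (snd (midpt s)) \<le> 1 / 2" if "a \<in> {-1, 1}" "b \<in> {-1, 1}" for a b s
    using that by (cases s) auto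
  then have "a * x + b * y \<le> 1 / 2" if "a \<in> {-1, 1}" "b \<in> {-1, 1}" for a b
    using that draw_in_halfspace[OF _ _ assms, of a b "1 / 2"] by auto
  from this[of 1 1] this[of 1 "-1"] this[of "-1" 1] this[of "-1" "-1"] show ?thesis
    by auto
qed

text \<open>Some tiles touch the region of a move in a corner where they have no end. Then they keep away from it
  by half a square.\<close>

lemma draw_away_from_side:
  assumes "(x, y, z) \<in> draw t"
  shows "Bottom \<notin> ends t \<Longrightarrow> 0 \<le> y" "Top \<notin> ends t \<Longrightarrow> y \<le> 0" "Right \<notin> ends t \<Longrightarrow> x \<le> 0"
proof -
  assume "Bottom \<notin> ends t"
  then have "0 * fst (midpt s) + - 1 * fst (snd (midpt s)) \<le> 0" if "s \<in> ends t" for s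
    using that by (cases s) auto
  from draw_in_halfspace[OF this _ assms] show "0 \<le> y" by simp
next
  assume "Top \<notin> ends t"
  then have "0 * fst (midpt s) + 1 * fst (snd (midpt s)) \<le> 0" if "s \<in> ends t" for s
    using that by (cases s) auto
  from draw_in_halfspace[OF this _ assms] show "y \<le> 0" by simp
next
  assume "Right \<notin> ends t"
  then have "1 * fst (midpt s) + 0 * fst (snd (midpt s)) \<le> 0" if "s \<in> ends t" for s
    using that by (cases s) auto
  from draw_in_halfspace[OF this _ assms] show "x \<le> 0" by simp
qed

lemma mem_segment_graph:
  fixes x1 x2 y1 y2 :: real
  assumes "x1 < x2"
  shows "(x, y, z) \<in> closed_segment (x1, y1, 0) (x2, y2, 0) \<longleftrightarrow>
    x1 \<le> x \<and> x \<le> x2 \<and> z = 0 \<and> (y - y1) * (x2 - x1) = (y2 - y1) * (x - x1)"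
proof
  assume "(x, y, z) \<in> closed_segment (x1, y1, 0) (x2, y2, 0)"
  then obtain u where u: "0 \<le> u" "u \<le> 1" and eq: "x = (1 - u) * x1 + u * x2"
    "y = (1 - u) * y1 + u * y2" "z = 0"
    by (auto simp: closed_segment_def)
  have d: "x - x1 = u * (x2 - x1)" "x2 - x = (1 - u) * (x2 - x1)" "y - y1 = u * (y2 - y1)"
    using eq by (simp_all add: algebra_simps)
  have "0 \<le> u * (x2 - x1)" "0 \<le> (1 - u) * (x2 - x1)"
    using u assms by simp_all
  then show "x1 \<le> x \<and> x \<le> x2 \<and> z = 0 \<and> (y - y1) * (x2 - x1) = (y2 - y1) * (x - x1)"
    using eq(3) by (simp add: d(1,3)) (use d in linarith)
next
  assume *: "x1 \<le> x \<and> x \<le> x2 \<and> z = 0 \<and> (y - y1) * (x2 - x1) = (y2 - y1) * (x - x1)"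
  define u where "u = (x - x1) / (x2 - x1)"
  have u: "0 \<le> u" "u \<le> 1"
    using * assms by (simp_all add: u_def)
  have "u * (x2 - x1) = x - x1" "u * (y2 - y1) = y - y1"
    using * assms by (simp_all add: u_def field_simps)
  then have "x = (1 - u) * x1 + u * x2" "y = (1 - u) * y1 + u * y2"
    by (simp_all add: algebra_simps)
  then show "(x, y, z) \<in> closed_segment (x1, y1, 0) (x2, y2, 0)"
    using * u by (auto simp: closed_segment_def)
qed

text \<open>The drawings of the tiles that take part in the moves, as graphs over the first coordinate.\<close>

lemma mem_draw_T1: "(x, y, z) \<in> draw T1 \<longleftrightarrow>
    z = 0 \<and> - 1 / 2 \<le> x \<and> x \<le> 0 \<and> y = min (- (x + 1 / 2) / 3) (- 1 / 2 - 3 * x)"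
  by (cases "x < - 1 / 8"; cases "x = - 1 / 8"; simp add: draw_def Let_def mem_segment_graph min_def; argo?)

lemma mem_draw_T2: "(x, y, z) \<in> draw T2 \<longleftrightarrow>
    z = 0 \<and> 0 \<le> x \<and> x \<le> 1 / 2 \<and> y = min (3 * x - 1 / 2) ((x - 1 / 2) / 3)"
  by (cases "x < 1 / 8"; cases "x = 1 / 8"; simp add: draw_def Let_def mem_segment_graph min_def; argo?)

lemma mem_draw_T3: "(x, y, z) \<in> draw T3 \<longleftrightarrow>
    z = 0 \<and> 0 \<le> x \<and> x \<le> 1 / 2 \<and> y = max ((1 / 2 - x) / 3) (1 / 2 - 3 * x)"
  by (cases "x < 1 / 8"; cases "x = 1 / 8"; simp add: draw_def Let_def mem_segment_graph max_def
      closed_segment_commute[of "(1 / 2, 0, 0)"] closed_segment_commute[of "(1 / 8, 1 / 8, 0)" "(0, 1 / 2, 0)"]; argo?)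

lemma mem_draw_T5: "(x, y, z) \<in> draw T5 \<longleftrightarrow> z = 0 \<and> - 1 / 2 \<le> x \<and> x \<le> 1 / 2 \<and> y = 0"
  by (simp add: draw_def Let_def mem_segment_graph) (safe; linarith)

section \<open>Two local moves\<close>

lemma picture_split: "picture D = (\<Union>c\<in>- C. (+) (site c) ` draw (D c)) \<union> (\<Union>c\<in>C. (+) (site c) ` draw (D c))"
  unfolding picture_def by blast

lemma matchedD: "matched D \<Longrightarrow> degree D V \<in> {0, 2}"
  unfolding matched_def by blast

text \<open>The contribution of one tile to \<^const>\<open>degree\<close>. Exchanging the tile at a site exchanges its contributions,
  which reduces the effect of a move on all degrees to the few corners of the tiles that it changes.\<close>

definition incidence :: "tile \<Rightarrow> int \<times> int \<Rightarrow> int \<times> int \<Rightarrow> nat"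
  where "incidence t c V =
    of_bool (Left \<in> ends t \<and> corner Left c = V) + of_bool (Bottom \<in> ends t \<and> corner Bottom c = V) +
    of_bool (Right \<in> ends t \<and> corner Right c = V) + of_bool (Top \<in> ends t \<and> corner Top c = V)"

lemma degree_upd: "degree (D(c := t)) V + incidence (D c) c V = degree D V + incidence t c V"
proof -
  obtain a b where V: "V = (a, b)" by (rule prod.exhaust)
  obtain i j where c: "c = (i, j)" by (rule prod.exhaust)
  have one: "of_bool (s \<in> ends ((D(c := t)) d)) + of_bool (s \<in> ends (D c) \<and> corner s c = V)
      = (of_bool (s \<in> ends (D d)) + of_bool (s \<in> ends t \<and> corner s c = V) :: nat)"
    if "d = c \<longleftrightarrow> corner s c = V" for s d
    using that by auto
  have "(a, b - 1) = c \<longleftrightarrow> corner Left c = V" "(a, b) = c \<longleftrightarrow> corner Bottom c = V"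
    "(a - 1, b) = c \<longleftrightarrow> corner Right c = V" "(a - 1, b - 1) = c \<longleftrightarrow> corner Top c = V"
    by (auto simp: V c)
  from this[THEN one] show ?thesis
    unfolding degree_def incidence_def by (simp add: V)
qed

text \<open>The cells \<open>(0, 1)\<close> and \<open>(1, 0)\<close> lie to the upper left and upper right of the vertex \<open>(0, 0)\<close>. The two arcs
  of the cap are the graph of a function over \<open>[- 1 / 2, 1 / 2]\<close> that vanishes at both ends, and the tile
  \<^const>\<open>T5\<close> at the vertex is the graph of \<open>0\<close>. The corner at the apex of the cap loses both of its curves;
  every other corner keeps its number of curves.\<close>

lemma cap_move:
  assumes D: "matched D" and tiles: "D (0, 1) = T2" "D (1, 0) = T1" "D (0, 0) = T0"
  shows "moves_to D (D((0, 1) := T0, (1, 0) := T0, (0, 0) := T5))"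
proof -
  let ?C = "{(0, 0), (0, 1), (1, 0)} :: (int \<times> int) set"
  let ?D' = "D((0, 1) := T0, (1, 0) := T0, (0, 0) := T5)"
  define R where "R = (\<Union>c\<in>- ?C. (+) (site c) ` draw (D c))"
  define f where "f x = min (3 * (1 / 2 - \<bar>x\<bar>)) (1 / 2 - \<bar>x\<bar> / 3)" for x :: real
  define Z where "Z = {(x, y, z). \<bar>x\<bar> \<le> 1 / 2 \<and> z = 0} \<inter> (UNIV :: point set)"
  have f_le: "f x \<le> 3 * (1 / 2 - \<bar>x\<bar>)" "f x \<le> 1 / 2 - \<bar>x\<bar> / 3" for x
    by (simp_all add: f_def)
  have "matched ?D'"
    unfolding matched_def
  proof
    fix V :: "int \<times> int"
    have "degree ?D' V + 2 * of_bool ((1, 1) = V) = degree D V"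
      using degree_upd[of D "(0, 1)" T0 V] degree_upd[of "D((0, 1) := T0)" "(1, 0)" T0 V]
        degree_upd[of "D((0, 1) := T0, (1, 0) := T0)" "(0, 0)" T5 V]
      by (simp add: incidence_def tiles)
    then show "degree ?D' V \<in> {0, 2}"
      using matchedD[OF D, of V] by (cases "(1, 1) = V") auto
  qed
  moreover have "isotopic (picture D) (picture ?D')"
  proof -
    have pic: "picture D = R \<union> {p \<in> Z. fst (snd p) = f (fst p)}"
    proof -
      have "(\<Union>c\<in>?C. (+) (site c) ` draw (D c)) = {p \<in> Z. fst (snd p) = f (fst p)}" (is "?L = ?G")
      proof (rule set_eqI)
        fix p :: point
        obtain x y z where p: "p = (x, y, z)" by (rule prod_cases3)
        have "p \<in> ?L \<longleftrightarrow> (x + 1 / 2, y - 1 / 2, z) \<in> draw T2 \<or> (x - 1 / 2, y - 1 / 2, z) \<in> draw T1"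
          by (simp add: p tiles site_def mem_translate draw_def[of T0])
        also have "\<dots> \<longleftrightarrow> p \<in> ?G"
          unfolding mem_draw_T1 mem_draw_T2
          by (cases "x < 0"; cases "x = 0"; auto simp: p Z_def f_def min_def abs_if; argo?)
        finally show "p \<in> ?L \<longleftrightarrow> p \<in> ?G" .
      qed
      then show ?thesis
        unfolding R_def by (subst picture_split[of _ ?C]) simp
    qed
    have pic': "picture ?D' = R \<union> {p \<in> Z. fst (snd p) = 0}"
    proof -
      have "(\<Union>c\<in>?C. (+) (site c) ` draw (?D' c)) = {p \<in> Z. fst (snd p) = 0}"
        by (auto simp: site_def mem_translate draw_def[of T0] mem_draw_T5 Z_def)
      moreover have "(\<Union>c\<in>- ?C. (+) (site c) ` draw (?D' c)) = R"
        unfolding R_def by (rule SUP_cong) auto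
      ultimately show ?thesis
        by (subst picture_split[of _ ?C]) simp
    qed
    have "isotopic (R \<union> {p \<in> Z. fst (snd p) = f (fst p)}) (R \<union> {p \<in> Z. fst (snd p) = 0})"
      (* Below, the region that moves leaves the end points along the sides of the square around the vertex,
         since f has slope 3 there. Above, it stays below 2 f, hence below the middle of the square around
         the vertex above the cap. *)
    proof (rule isotopic_push_graph[where \<sigma> = fst and \<eta> = "\<lambda>p. fst (snd p)" and f = f and
          g = "\<lambda>_. 0" and e = "(0, 1, 0)" and lo = "\<lambda>x. - 1 / 3 * f x" and
          A = "3 / 4" and B = 1 and C = "1 / 2"])
      show "continuous_on UNIV f"
        unfolding f_def by (intro continuous_intros) simp
      then show "continuous_on UNIV (\<lambda>x. - 1 / 3 * f x)"
        by (intro continuous_intros)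
      show "False" if p: "p \<in> R" and f: "0 < f (fst p)" and lo: "- 1 / 3 * f (fst p) < fst (snd p)"
        and hi: "1 * (fst (snd p) - f (fst p)) < f (fst p) - 0" for p
      proof -
        obtain x y z where xyz: "p = (x, y, z)" by (rule prod_cases3)
        obtain c where "c \<in> - ?C" "p \<in> (+) (site c) ` draw (D c)"
          using p unfolding R_def by (rule UN_E)
        moreover obtain a b where "c = (a, b)" by (rule prod.exhaust)
        ultimately have ab: "(a, b) \<notin> ?C" "p \<in> (+) (site (a, b)) ` draw (D (a, b))"
          by simp_all
        define m n where "m = a - b" and "n = a + b"
        have in_draw: "(x - m / 2, y - n / 2, z) \<in> draw (D (a, b))"
          using ab(2) by (simp add: xyz site_def mem_translate m_def n_def)
        have dia: "\<bar>x - m / 2\<bar> + \<bar>y - n / 2\<bar> \<le> 1 / 2"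
          using draw_in_diamond[OF in_draw] .
        have x: "\<bar>x\<bar> < 1 / 2" and y: "\<bar>x\<bar> - 1 / 2 < y" "y < 1"
          using f lo hi f_le[of x] abs_ge_zero[of x] unfolding xyz fst_conv snd_conv by argo+
        have m: "- 2 < m" "m < 2"
          using x dia by linarith+
        have n: "- 2 < n" "n < 3"
          using x y dia by linarith+
        (* The apex of the cap already has two curves, so none of the square above it ends there. *)
        have "Bottom \<notin> ends (D (1, 1))"
          using matchedD[OF D, of "(1, 1)"] tiles by (auto simp: degree_def)
        then have "(a, b) \<noteq> (1, 1)"
          using draw_away_from_side(1)[OF in_draw] y by (auto simp: n_def)
        moreover have "n = -1 \<Longrightarrow> m \<noteq> 1" "n = -1 \<Longrightarrow> m \<noteq> -1"
          using dia x y by (clarsimp; argo)+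
        ultimately show False
          using m n ab(1) unfolding m_def n_def by simp presburger
      qed
    qed (auto simp: Z_def f_def split_beta min_def abs_if intro!: continuous_intros split: if_splits)
    then show ?thesis
      by (simp only: pic pic')
  qed
  ultimately show ?thesis
    by (simp add: moves_to_def)
qed

text \<open>Here the vertex \<open>(0, 0)\<close> carries the diagonal left by a cap below it, and the cell \<open>(0, 1)\<close> carries an arc
  of a cap above it. The path along the diagonal from right to left and then up the arc starts
  horizontally and bends back to the right, so it is a graph over neither a horizontal nor a vertical line, but \<open>4 y - x\<close> increases along it,
  as it does along the arc of \<^const>\<open>T3\<close> that replaces it. The lines along which points are pushed are
  therefore parallel to \<open>(4, 1)\<close>.\<close>

lemma fold_move:
  assumes D: "matched D" and tiles: "D (0, 0) = T5" "D (0, 1) = T2"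
  shows "moves_to D (D((0, 1) := T0, (0, 0) := T3))"
proof -
  let ?C = "{(0, 0), (0, 1)} :: (int \<times> int) set"
  let ?D' = "D((0, 1) := T0, (0, 0) := T3)"
  define R where "R = (\<Union>c\<in>- ?C. (+) (site c) ` draw (D c))"
  define f where "f s = min 0 (min (3 / 11 * (1 / 2 - s)) (3 / 2 - s))" for s :: real
  define g where "g s = min (- 1 / 7 * (s + 1 / 2)) (- 1 / 26 - 3 / 13 * s)" for s :: real
  define lo where "lo s = - 1 / 5 * (s + 1 / 2)" for s :: real
  define \<sigma> where "\<sigma> p = 4 * fst (snd p) - fst p" for p :: point
  define \<eta> where "\<eta> p = - fst (snd p)" for p :: point
  define Z where "Z = {p :: point. snd (snd p) = 0 \<and> - 1 / 2 \<le> \<sigma> p \<and> \<sigma> p \<le> 2}"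
  have cont: "continuous_on UNIV f" "continuous_on UNIV g" "continuous_on UNIV lo"
      "continuous_on UNIV \<sigma>" "continuous_on UNIV \<eta>"
    unfolding f_def g_def lo_def \<sigma>_def \<eta>_def by (intro continuous_intros)+
  have f_le: "f s \<le> 0" "f s \<le> 3 / 11 * (1 / 2 - s)" "f s \<le> 3 / 2 - s"
    and f_cases: "f s = 0 \<or> f s = 3 / 11 * (1 / 2 - s) \<or> f s = 3 / 2 - s" for s
    by (auto simp: f_def min_def)
  have g_le: "g s \<le> - 1 / 7 * (s + 1 / 2)" "g s \<le> - 1 / 26 - 3 / 13 * s"
    and g_cases: "g s = - 1 / 7 * (s + 1 / 2) \<or> g s = - 1 / 26 - 3 / 13 * s" for s
    by (auto simp: g_def min_def)
  have "matched ?D'"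
    unfolding matched_def
  proof
    fix V :: "int \<times> int"
    have "degree ?D' V + 2 * of_bool ((0, 1) = V) = degree D V"
      using degree_upd[of D "(0, 1)" T0 V] degree_upd[of "D((0, 1) := T0)" "(0, 0)" T3 V]
      by (simp add: incidence_def tiles)
    then show "degree ?D' V \<in> {0, 2}"
      using matchedD[OF D, of V] by (cases "(0, 1) = V") auto
  qed
  moreover have "isotopic (picture D) (picture ?D')"
  proof -
    have pic: "picture D = R \<union> {p \<in> Z. \<eta> p = f (\<sigma> p)}"
    proof -
      have "(\<Union>c\<in>?C. (+) (site c) ` draw (D c)) = {p \<in> Z. \<eta> p = f (\<sigma> p)}" (is "?L = ?G")
      proof (rule set_eqI)
        fix p :: point
        obtain x y z where p: "p = (x, y, z)" by (rule prod_cases3)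
        have "p \<in> ?L \<longleftrightarrow> (x, y, z) \<in> draw T5 \<or> (x + 1 / 2, y - 1 / 2, z) \<in> draw T2"
          by (simp add: p tiles site_def mem_translate)
        also have "\<dots> \<longleftrightarrow> p \<in> ?G"
          unfolding mem_draw_T5 mem_draw_T2
          by (auto simp: p Z_def f_def \<sigma>_def \<eta>_def min_def; argo?)
        finally show "p \<in> ?L \<longleftrightarrow> p \<in> ?G" .
      qed
      then show ?thesis
        unfolding R_def by (subst picture_split[of _ ?C]) simp
    qed
    have pic': "picture ?D' = R \<union> {p \<in> Z. \<eta> p = g (\<sigma> p)}"
    proof -
      have "(\<Union>c\<in>?C. (+) (site c) ` draw (?D' c)) = {p \<in> Z. \<eta> p = g (\<sigma> p)}" (is "?L = ?G")
      proof (rule set_eqI)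
        fix p :: point
        obtain x y z where p: "p = (x, y, z)" by (rule prod_cases3)
        have "p \<in> ?L \<longleftrightarrow> (x, y, z) \<in> draw T3"
          by (simp add: p site_def mem_translate draw_def[of T0])
        also have "\<dots> \<longleftrightarrow> p \<in> ?G"
          unfolding mem_draw_T3
          by (auto simp: p Z_def g_def \<sigma>_def \<eta>_def min_def max_def; argo?)
        finally show "p \<in> ?L \<longleftrightarrow> p \<in> ?G" .
      qed
      moreover have "(\<Union>c\<in>- ?C. (+) (site c) ` draw (?D' c)) = R"
        unfolding R_def by (rule SUP_cong) auto
      ultimately show ?thesis
        by (subst picture_split[of _ ?C]) simp
    qed
    have "isotopic (R \<union> {p \<in> Z. \<eta> p = f (\<sigma> p)}) (R \<union> {p \<in> Z. \<eta> p = g (\<sigma> p)})"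
      (* The line lo joins the ends of the paths, along a side of the square around the vertex. The rate A
         is the ratio of f - g to f - lo near the upper end, and B is large enough to keep the region
         away from the far halves of the squares to the left and to the lower left. *)
    proof (rule isotopic_push_graph[where \<sigma> = \<sigma> and \<eta> = \<eta> and f = f and g = g and
          lo = lo and e = "(- 4, - 1, 0)" and A = "25 / 26" and B = 8 and C = 1])
      show "f s - g s \<le> 25 / 26 * (f s - lo s)" if "g s \<le> f s" for s
        using that f_le[of s] g_cases[of s] f_cases[of s] g_le[of s] unfolding lo_def by argo
      show "f s - g s \<le> 1" for s
        using f_le[of s] g_cases[of s] by argo
      show "g (\<sigma> p) \<le> f (\<sigma> p)" if "p \<in> Z" for p
        using that g_le[of "\<sigma> p"] f_cases[of "\<sigma> p"] unfolding Z_def mem_Collect_eq by argo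
      show "False" if p: "p \<in> R" and gf: "g (\<sigma> p) < f (\<sigma> p)" and lo: "lo (\<sigma> p) < \<eta> p"
        and hi: "8 * (\<eta> p - f (\<sigma> p)) < f (\<sigma> p) - g (\<sigma> p)" for p
      proof -
        obtain x y z where xyz: "p = (x, y, z)" by (rule prod_cases3)
        obtain c where "c \<in> - ?C" "p \<in> (+) (site c) ` draw (D c)"
          using p unfolding R_def by (rule UN_E)
        moreover obtain a b where "c = (a, b)" by (rule prod.exhaust)
        ultimately have ab: "(a, b) \<notin> ?C" "p \<in> (+) (site (a, b)) ` draw (D (a, b))"
          by simp_all
        define m n where "m = a - b" and "n = a + b"
        have in_draw: "(x - m / 2, y - n / 2, z) \<in> draw (D (a, b))"
          using ab(2) by (simp add: xyz site_def mem_translate m_def n_def)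
        have dia: "\<bar>x - m / 2\<bar> + \<bar>y - n / 2\<bar> \<le> 1 / 2"
          using draw_in_diamond[OF in_draw] .
        define s where "s = 4 * y - x"
        have \<sigma>: "\<sigma> p = s" and \<eta>: "\<eta> p = - y"
          by (simp_all add: xyz \<sigma>_def \<eta>_def s_def)
        have s: "- 1 / 2 < s" "s < 2"
          using gf f_le[of s] g_cases[of s] unfolding \<sigma> by argo+
        have xy: "x + y < 1 / 2" "y < 1 / 2" "x - y < 1 / 2"
          using lo s unfolding \<sigma> \<eta> lo_def s_def by argo+
        have lower: "- 1 / 2 < y" "- 1 < x"
          using hi f_le[of s] f_cases[of s] g_cases[of s] s unfolding \<sigma> \<eta> s_def by argo+
        have m: "- 3 < m" "m < 2"
          using xy lower dia by linarith+
        have n: "- 2 < n" "n < 2"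
          using xy lower dia by linarith+
        (* The corner where diagonal and arc meet already has two curves. *)
        have "Right \<notin> ends (D (-1, 1))" "Top \<notin> ends (D (-1, 0))"
          using matchedD[OF D, of "(0, 1)"] tiles by (auto simp: degree_def)
        then have "(a, b) \<noteq> (-1, 1)" "(a, b) \<noteq> (-1, 0)"
          using draw_away_from_side(2,3)[OF in_draw] lower by (auto simp: n_def m_def)
        moreover have "n = 1 \<Longrightarrow> m \<noteq> 1" "n = -1 \<Longrightarrow> m \<noteq> 1"
          using dia xy by (clarsimp; argo)+
        ultimately show False
          using m n ab(1) unfolding m_def n_def by simp presburger
      qed
    qed (use cont in \<open>auto simp: Z_def \<sigma>_def \<eta>_def\<close>)
    then show ?thesis
      by (simp only: pic pic')
  qed
  ultimately show ?thesis
    by (simp add: moves_to_def)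
qed

section \<open>Rotating and translating diagrams\<close>

text \<open>Counterclockwise rotation by \<open>\<pi> / 2\<close> of tiles, sites and diagrams.\<close>

fun rot_tile :: "tile \<Rightarrow> tile" where
  "rot_tile T0 = T0"
| "rot_tile T1 = T2"
| "rot_tile T2 = T3"
| "rot_tile T3 = T4"
| "rot_tile T4 = T1"
| "rot_tile T5 = T6"
| "rot_tile T6 = T5"
| "rot_tile T7 = T8"
| "rot_tile T8 = T7"
| "rot_tile T9 = T10"
| "rot_tile T10 = T9"

definition quarter :: "int \<times> int \<Rightarrow> int \<times> int"
  where "quarter = (\<lambda>(a, b). (- b, a))"

definition rotate :: "diagram \<Rightarrow> diagram"
  where "rotate D = (\<lambda>(a, b). rot_tile (D (b, - a)))"

definition translate :: "int \<times> int \<Rightarrow> diagram \<Rightarrow> diagram"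
  where "translate w D = (\<lambda>c. D (c - w))"

lemma rot_tile_4: "rot_tile (rot_tile (rot_tile (rot_tile t))) = t"
  by (cases t) simp_all

lemma rot_tile_eq_T0: "rot_tile t = T0 \<longleftrightarrow> t = T0"
  by (cases t) simp_all

lemma spiral_add: "spiral a b (p + q) = spiral a b p + spiral a b q"
  by (cases p; cases q) (simp add: spiral_def algebra_simps)

lemma linear_spiral: "linear (spiral a b)"
  by (rule linearI) (auto simp: spiral_add spiral_def algebra_simps)

lemma spiral_apply: "spiral a b (x, y, z) = (a * x - b * y, b * x + a * y, z)"
  by (simp add: spiral_def)

lemma draw_rot_tile: "draw (rot_tile t) = spiral 0 1 ` draw t"
  by (cases t)
    (simp_all add: draw_def Let_def image_Un Un_ac spiral_apply
      closed_segment_linear_image[OF linear_spiral, symmetric] closed_segment_commute)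

lemma ends_rot_tile:
  "Left \<in> ends (rot_tile t) \<longleftrightarrow> Top \<in> ends t" "Bottom \<in> ends (rot_tile t) \<longleftrightarrow> Left \<in> ends t"
  "Right \<in> ends (rot_tile t) \<longleftrightarrow> Bottom \<in> ends t" "Top \<in> ends (rot_tile t) \<longleftrightarrow> Right \<in> ends t"
  by (cases t; simp)+

lemma site_quarter: "site (quarter c) = spiral 0 1 (site c)"
  by (cases c) (simp add: site_def quarter_def spiral_def, simp add: field_simps)

lemma site_add: "site (c + d) = site c + site d"
  by (cases c; cases d) (simp add: site_def add_divide_distrib diff_divide_distrib)

lemma rotate_quarter: "rotate D (quarter c) = rot_tile (D c)"
  by (cases c) (simp add: rotate_def quarter_def)

lemma surj_quarter: "surj quarter"
  by (rule surjI[of _ "\<lambda>(a, b). (b, - a)"]) (auto simp: quarter_def)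

lemma picture_rotate: "picture (rotate D) = spiral 0 1 ` picture D"
proof -
  have "picture (rotate D) = (\<Union>c. (+) (site (quarter c)) ` draw (rotate D (quarter c)))"
    unfolding picture_def by (subst surj_quarter[symmetric]) (simp add: image_image)
  then show ?thesis
    by (simp add: rotate_quarter site_quarter draw_rot_tile picture_def image_UN image_image spiral_add)
qed

lemma picture_translate: "picture (translate w D) = (+) (site w) ` picture D"
proof -
  have "picture (translate w D) = (\<Union>c. (+) (site (w + c)) ` draw (translate w D (w + c)))"
  proof -
    have "surj ((+) w)" by (rule surj_plus)
    then show ?thesis
      unfolding picture_def by (metis (no_types, lifting) image_image SUP_cong)
  qed
  then show ?thesis
    by (simp add: translate_def site_add picture_def image_UN image_image add.assoc)
qed

lemma degree_rotate: "degree (rotate D) (a, b) = degree D (b, 1 - a)"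
  by (simp add: degree_def rotate_def ends_rot_tile)

lemma degree_translate: "degree (translate w D) V = degree D (V - w)"
  by (cases V; cases w) (simp add: degree_def translate_def algebra_simps)

lemma matched_rotate: "matched (rotate D) \<longleftrightarrow> matched D"
proof
  assume *: "matched (rotate D)"
  show "matched D"
    unfolding matched_def
  proof
    fix V :: "int \<times> int"
    show "degree D V \<in> {0, 2}"
      using matchedD[OF *, of "(1 - snd V, fst V)"] by (simp add: degree_rotate)
  qed
next
  assume *: "matched D"
  show "matched (rotate D)"
    unfolding matched_def
  proof
    fix V :: "int \<times> int"
    show "degree (rotate D) V \<in> {0, 2}"
      using matchedD[OF *] by (cases V) (simp only: degree_rotate)
  qed
qed

lemma matched_translate: "matched (translate w D) \<longleftrightarrow> matched D"
  unfolding matched_def degree_translate by (metis add_diff_cancel)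

lemma moves_to_rotate:
  assumes "moves_to D D'"
  shows "moves_to (rotate D) (rotate D')"
proof -
  have "isotopic X (spiral 0 1 ` X)" for X
    by (rule isotopic_spiral) simp_all
  then show ?thesis
    using assms unfolding moves_to_def picture_rotate matched_rotate
    by (meson isotopic_sym isotopic_trans)
qed

lemma moves_to_translate:
  assumes "moves_to D D'"
  shows "moves_to (translate w D) (translate w D')"
  using assms isotopic_translate unfolding moves_to_def picture_translate matched_translate
  by (meson isotopic_sym isotopic_trans)

fun overwrite :: "((int \<times> int) \<times> tile) list \<Rightarrow> diagram \<Rightarrow> diagram" where
  "overwrite [] D = D"
| "overwrite ((c, t) # Q) D = overwrite Q (D(c := t))"

text \<open>Lists of placed tiles describe a move as data, which can be rotated and translated entry by entry.\<close>

definition local_move :: "((int \<times> int) \<times> tile) list \<Rightarrow> ((int \<times> int) \<times> tile) list \<Rightarrow> bool"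
  where "local_move P Q \<longleftrightarrow>
    (\<forall>D. matched D \<longrightarrow> (\<forall>(c, t)\<in>set P. D c = t) \<longrightarrow> moves_to D (overwrite Q D))"

lemma quarter_eq_iff: "quarter c = quarter d \<longleftrightarrow> c = d"
  by (cases c; cases d) (auto simp: quarter_def)

lemma rotate_overwrite: "rotate (overwrite Q D) = overwrite (map (map_prod quarter rot_tile) Q) (rotate D)"
proof (induction Q arbitrary: D)
  case (Cons ct Q)
  obtain c t where ct: "ct = (c, t)" by (rule prod.exhaust)
  have "rotate (D(c := t)) = (rotate D)(quarter c := rot_tile t)"
  proof
    fix d
    obtain d' where d: "d = quarter d'" using surj_quarter by (rule surjE)
    show "rotate (D(c := t)) d = ((rotate D)(quarter c := rot_tile t)) d"
      by (simp add: d rotate_quarter quarter_eq_iff)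
  qed
  then show ?case by (simp add: ct Cons.IH del: fun_upd_apply)
qed simp

lemma translate_overwrite: "translate w (overwrite Q D) = overwrite (map (map_prod ((+) w) id) Q) (translate w D)"
proof (induction Q arbitrary: D)
  case (Cons ct Q)
  obtain c t where ct: "ct = (c, t)" by (rule prod.exhaust)
  have "translate w (D(c := t)) = (translate w D)(w + c := t)"
    by (auto simp: translate_def fun_eq_iff)
  then show ?case by (simp add: ct Cons.IH del: fun_upd_apply)
qed simp

text \<open>Rotate back, apply the move there, and rotate the result.\<close>

lemma local_move_rotate:
  assumes "local_move P Q"
  shows "local_move (map (map_prod quarter rot_tile) P) (map (map_prod quarter rot_tile) Q)"
  unfolding local_move_def
proof (intro allI impI)
  fix D assume D: "matched D" and P: "\<forall>(c, t)\<in>set (map (map_prod quarter rot_tile) P). D c = t"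
  define E where "E c = rot_tile (rot_tile (rot_tile (D (quarter c))))" for c
  have rot: "rotate E = D"
    by (auto simp: rotate_def E_def rot_tile_4 quarter_def)
  have "matched E"
    using D by (simp flip: rot add: matched_rotate)
  moreover have "\<forall>(c, t)\<in>set P. E c = t"
    using P unfolding set_map by (auto simp: E_def rot_tile_4 map_prod_def)
  ultimately have "moves_to E (overwrite Q E)"
    using assms by (simp add: local_move_def)
  then show "moves_to D (overwrite (map (map_prod quarter rot_tile) Q) D)"
    using moves_to_rotate rotate_overwrite rot by metis
qed

lemma local_move_translate:
  assumes "local_move P Q"
  shows "local_move (map (map_prod ((+) w) id) P) (map (map_prod ((+) w) id) Q)"
  unfolding local_move_def
proof (intro allI impI)
  fix D assume D: "matched D" and P: "\<forall>(c, t)\<in>set (map (map_prod ((+) w) id) P). D c = t"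
  define E where "E c = D (w + c)" for c
  have tr: "translate w E = D"
    by (auto simp: translate_def E_def)
  have "matched E"
    using D by (simp flip: tr add: matched_translate)
  moreover have "\<forall>(c, t)\<in>set P. E c = t"
    using P unfolding set_map by (auto simp: E_def map_prod_def)
  ultimately have "moves_to E (overwrite Q E)"
    using assms by (simp add: local_move_def)
  then show "moves_to D (overwrite (map (map_prod ((+) w) id) Q) D)"
    using moves_to_translate translate_overwrite tr by metis
qed

lemma local_move_at:
  assumes "local_move P Q"
  shows "local_move (map (map_prod (\<lambda>c. w + (quarter ^^ r) c) (rot_tile ^^ r)) P)
    (map (map_prod (\<lambda>c. w + (quarter ^^ r) c) (rot_tile ^^ r)) Q)"
proof -
  have "local_move (map (map_prod (quarter ^^ r) (rot_tile ^^ r)) P)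
      (map (map_prod (quarter ^^ r) (rot_tile ^^ r)) Q)"
  proof (induction r)
    case 0
    then show ?case using assms by (simp add: prod.map_id0)
  next
    case (Suc r)
    from local_move_rotate[OF this] show ?case
      by (simp add: o_def prod.map_comp)
  qed
  from local_move_translate[OF this, of w] show ?thesis
    by (simp add: o_def prod.map_comp)
qed

lemma quarter_funpow_0: "(quarter ^^ r) (0, 0) = 0"
  by (induction r) (simp_all add: quarter_def zero_prod_def)

lemma rot_tile_funpow_T0: "(rot_tile ^^ r) T0 = T0"
  by (induction r) simp_all

lemma cap_move_at:
  assumes "matched D" "D (w + (quarter ^^ r) (0, 1)) = (rot_tile ^^ r) T2"
    "D (w + (quarter ^^ r) (1, 0)) = (rot_tile ^^ r) T1" "D w = T0"
  shows "moves_to D (D(w + (quarter ^^ r) (0, 1) := T0, w + (quarter ^^ r) (1, 0) := T0,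
    w := (rot_tile ^^ r) T5))"
proof -
  have "local_move [((0, 1), T2), ((1, 0), T1), ((0, 0), T0)] [((0, 1), T0), ((1, 0), T0), ((0, 0), T5)]"
    unfolding local_move_def using cap_move by simp
  from local_move_at[OF this, of w r] show ?thesis
    using assms by (simp add: local_move_def quarter_funpow_0 rot_tile_funpow_T0)
qed

lemma fold_move_at:
  assumes "matched D" "D w = (rot_tile ^^ r) T5" "D (w + (quarter ^^ r) (0, 1)) = (rot_tile ^^ r) T2"
  shows "moves_to D (D(w + (quarter ^^ r) (0, 1) := T0, w := (rot_tile ^^ r) T3))"
proof -
  have "local_move [((0, 0), T5), ((0, 1), T2)] [((0, 1), T0), ((0, 0), T3)]"
    unfolding local_move_def using fold_move by simp
  from local_move_at[OF this, of w r] show ?thesis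
    using assms by (simp add: local_move_def quarter_funpow_0 rot_tile_funpow_T0)
qed

section \<open>Straightening a family of disjoint caps\<close>

definition support :: "diagram \<Rightarrow> (int \<times> int) set"
  where "support D = {c. D c \<noteq> T0}"

definition odd_site :: "int \<times> int \<Rightarrow> bool"
  where "odd_site c \<longleftrightarrow> odd (fst c + snd c)"

text \<open>A cap is given by its vertex and the number of quarter turns that take a \<open>\<inter>\<close> to it. The feet are its
  two cells.\<close>

fun feet :: "(int \<times> int) \<times> nat \<Rightarrow> (int \<times> int) set" where
  "feet (w, r) = {w + (quarter ^^ r) (0, 1), w + (quarter ^^ r) (1, 0)}"

fun cap_at :: "diagram \<Rightarrow> (int \<times> int) \<times> nat \<Rightarrow> bool" where
  "cap_at D (w, r) \<longleftrightarrow> r < 4 \<and> odd_site w \<and>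
    D (w + (quarter ^^ r) (0, 1)) = (rot_tile ^^ r) T2 \<and>
    D (w + (quarter ^^ r) (1, 0)) = (rot_tile ^^ r) T1"

lemma less_4_cases: "(r::nat) < 4 \<Longrightarrow> r = 0 \<or> r = 1 \<or> r = 2 \<or> r = 3"
  by linarith

lemma odd_site_add: "odd_site (c + d) \<longleftrightarrow> odd_site c \<noteq> odd_site d"
  by (auto simp: odd_site_def)

lemma feet_even:
  assumes "odd_site w" "c \<in> feet (w, r)"
  shows "\<not> odd_site c"
proof -
  have "odd_site ((quarter ^^ r) c) \<longleftrightarrow> odd_site c" for c
    by (induction r) (auto simp: quarter_def odd_site_def split_beta)
  then have "odd_site ((quarter ^^ r) (0, 1))" "odd_site ((quarter ^^ r) (1, 0))"
    by (simp_all add: odd_site_def)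
  then show ?thesis
    using assms by (auto simp: odd_site_add)
qed

lemma feet_distinct: "w + (quarter ^^ r) (0, 1) \<noteq> w + (quarter ^^ r) (1, 0)"
  by (induction r) (simp_all add: quarter_eq_iff)

text \<open>Caps at the same vertex that differ by one quarter turn share a cell.\<close>

lemma opposite_caps:
  assumes "r < 4" "r' < 4" "r \<noteq> r'" "feet (w, r) \<inter> feet (w, r') = {}"
  shows "r' = (r + 2) mod 4" "(rot_tile ^^ r') T5 = (rot_tile ^^ r) T5"
proof -
  have powers: "(quarter ^^ 2) (0, 1) = (0, -1)" "(quarter ^^ 2) (1, 0) = (-1, 0)"
    "(quarter ^^ 3) (0, 1) = (1, 0)" "(quarter ^^ 3) (1, 0) = (0, -1)"
    "(rot_tile ^^ 2) T5 = T5" "(rot_tile ^^ 3) T5 = T6"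
    "quarter (0, 1) = (-1, 0)" "quarter (1, 0) = (0, 1)"
    by (simp_all add: numeral_2_eq_2 numeral_3_eq_3 quarter_def)
  have "r' = (r + 2) mod 4 \<and> (rot_tile ^^ r') T5 = (rot_tile ^^ r) T5"
    using less_4_cases[OF assms(1)] less_4_cases[OF assms(2)] assms(3,4)
    by (elim disjE) (simp_all add: powers)
  then show "r' = (r + 2) mod 4" "(rot_tile ^^ r') T5 = (rot_tile ^^ r) T5"
    by blast+
qed

lemma rot_tile_funpow_eq_T0: "(rot_tile ^^ r) t = T0 \<longleftrightarrow> t = T0"
  by (induction r) (simp_all add: rot_tile_eq_T0)

lemma T0_eq_rot_tile_funpow: "T0 = (rot_tile ^^ r) t \<longleftrightarrow> t = T0"
  using rot_tile_funpow_eq_T0[of r t] by auto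

text \<open>The caps are worked off one at a time. The last three conjuncts keep the induction going: the cells of
  the caps still to come are unchanged, and a vertex with such a cap is either empty, so that \<open>cap_move\<close>
  applies, or carries the diagonal left by the opposite cap, so that \<open>fold_move\<close> applies. Nothing is claimed
  about a vertex with two caps, because no third disjoint cap fits there.\<close>

lemma straighten_caps:
  assumes "finite K" and caps: "\<forall>k\<in>K. cap_at D k"
    and disj: "\<forall>k\<in>K. \<forall>l\<in>K. k \<noteq> l \<longrightarrow> feet k \<inter> feet l = {}"
    and D: "matched D" "finite (support D)" "\<forall>w. odd_site w \<longrightarrow> D w = T0"
  shows "\<exists>E. moves_to D E \<and> finite (support E) \<and> card (support E) + card K \<le> card (support D) \<and>
    (\<forall>c. \<not> odd_site c \<longrightarrow> c \<notin> \<Union> (feet ` K) \<longrightarrow> E c = D c) \<and>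
    (\<forall>w. odd_site w \<longrightarrow> (\<forall>r. (w, r) \<notin> K) \<longrightarrow> E w = T0) \<and>
    (\<forall>w r. (w, r) \<in> K \<longrightarrow> (\<forall>r'. (w, r') \<in> K \<longrightarrow> r' = r) \<longrightarrow> E w = (rot_tile ^^ r) T5)"
  using \<open>finite K\<close> caps disj
proof (induction K rule: finite_induct)
  case empty
  have "moves_to D D"
    using D(1) isotopic_translate[of "picture D" 0] by (simp add: moves_to_def image_def)
  then show ?case using D by auto
next
  case (insert k K)
  obtain w r where k: "k = (w, r)" by (rule prod.exhaust)
  have "cap_at D k" using insert.prems(1) by blast
  then have r: "r < 4" and w: "odd_site w"
    and foot1: "D (w + (quarter ^^ r) (0, 1)) = (rot_tile ^^ r) T2"
    and foot2: "D (w + (quarter ^^ r) (1, 0)) = (rot_tile ^^ r) T1"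
    by (simp_all add: k)
  let ?f1 = "w + (quarter ^^ r) (0, 1)" and ?f2 = "w + (quarter ^^ r) (1, 0)"
  obtain E where E: "moves_to D E" "finite (support E)" "card (support E) + card K \<le> card (support D)"
    and even': "\<forall>c. \<not> odd_site c \<longrightarrow> c \<notin> \<Union> (feet ` K) \<longrightarrow> E c = D c"
    and free': "\<forall>w. odd_site w \<longrightarrow> (\<forall>r. (w, r) \<notin> K) \<longrightarrow> E w = T0"
    and single': "\<forall>w r. (w, r) \<in> K \<longrightarrow> (\<forall>r'. (w, r') \<in> K \<longrightarrow> r' = r) \<longrightarrow> E w = (rot_tile ^^ r) T5"
  proof -
    have "\<forall>k\<in>K. cap_at D k" "\<forall>k\<in>K. \<forall>l\<in>K. k \<noteq> l \<longrightarrow> feet k \<inter> feet l = {}"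
      using insert.prems by simp_all
    from insert.IH[OF this] show thesis
      by (elim exE conjE) (rule that)
  qed
  note even = even'[rule_format] and free = free'[THEN spec, THEN mp, THEN mp]
    and single = single'[THEN spec, THEN spec, THEN mp, THEN mp]
  have feet_free: "c \<notin> \<Union> (feet ` K)" if "c \<in> feet k" for c
  proof -
    have "feet k \<inter> feet l = {}" if "l \<in> K" for l
      using insert.prems(2) insert.hyps(2) that by (metis insertCI)
    then show ?thesis using that by blast
  qed
  have f_even: "\<not> odd_site ?f1" "\<not> odd_site ?f2"
    using feet_even[OF w, of _ r] by simp_all
  have Ef: "E ?f1 = (rot_tile ^^ r) T2" "E ?f2 = (rot_tile ^^ r) T1"
    using even f_even feet_free foot1 foot2 by (simp_all add: k)
  have ne: "?f1 \<noteq> w" "?f2 \<noteq> w" "?f1 \<noteq> ?f2"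
    using f_even w feet_distinct by metis+
  have mE: "matched E" and iso: "isotopic (picture D) (picture E)"
    using E(1) by (simp_all add: moves_to_def)
  have move: "moves_to D E'" if "moves_to E E'" for E'
    using that iso isotopic_trans unfolding moves_to_def by blast
  have cardK: "card (insert k K) = card K + 1"
    using insert.hyps by simp
  show ?case
  proof (cases "\<exists>r'. (w, r') \<in> K")
    case False
    define E' where "E' = E(?f1 := T0, ?f2 := T0, w := (rot_tile ^^ r) T5)"
    have Ew: "E w = T0" using free[OF w] False by blast
    have "moves_to D E'"
      unfolding E'_def by (intro move cap_move_at mE Ef Ew)
    moreover have sup: "support E' = insert w (support E - {?f1, ?f2})"
      using ne by (auto simp: support_def E'_def rot_tile_funpow_eq_T0 T0_eq_rot_tile_funpow)
    have "card (support E') + card (insert k K) \<le> card (support D)"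
    proof -
      have sub: "{?f1, ?f2} \<subseteq> support E"
        using Ef by (simp add: support_def rot_tile_funpow_eq_T0)
      have "card (support E - {?f1, ?f2}) = card (support E) - 2"
        using card_Diff_subset[OF _ sub] ne by simp
      moreover have "2 \<le> card (support E)"
        using card_mono[OF E(2) sub] ne by simp
      moreover have "card (support E') = card (support E - {?f1, ?f2}) + 1"
        using E(2) Ew unfolding sup by (simp add: support_def)
      ultimately show ?thesis
        using E(3) cardK by simp
    qed
    moreover have "finite (support E')"
      using E(2) by (simp add: sup)
    moreover have "E' c = D c" if "\<not> odd_site c" "c \<notin> \<Union> (feet ` insert k K)" for c
      using that even[of c] w by (auto simp: E'_def k)
    moreover have "E' v = T0" if "odd_site v" "\<forall>r. (v, r) \<notin> insert k K" for v
      using that free[of v] f_even by (auto simp: E'_def k)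
    moreover have "E' v = (rot_tile ^^ q) T5"
      if "(v, q) \<in> insert k K" "\<forall>q'. (v, q') \<in> insert k K \<longrightarrow> q' = q" for v q
    proof (cases "v = w")
      case True
      then show ?thesis using that False by (auto simp: E'_def k)
    next
      case v: False
      then have "(v, q) \<in> K" using that(1) by (simp add: k)
      then have "odd_site v" using insert.prems(1) by auto
      then have "E' v = E v" using v f_even by (auto simp: E'_def)
      then show ?thesis using single[OF \<open>(v, q) \<in> K\<close>] that(2) by auto
    qed
    ultimately show ?thesis
      by (intro exI[of _ E']) blast
  next
    case True
    then obtain r' where r': "(w, r') \<in> K" by blast
    define E' where "E' = E(?f1 := T0, w := (rot_tile ^^ r) T3)"
    have opp: "q = (r + 2) mod 4" "(rot_tile ^^ q) T5 = (rot_tile ^^ r) T5" if "(w, q) \<in> K" for q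
    proof -
      have "(w, q) \<noteq> k" using that insert.hyps(2) by blast
      then have "feet (w, r) \<inter> feet (w, q) = {}" "r \<noteq> q"
        using insert.prems(2) that by (auto simp: k)
      moreover have "q < 4" using insert.prems(1) that by auto
      ultimately show "q = (r + 2) mod 4" "(rot_tile ^^ q) T5 = (rot_tile ^^ r) T5"
        using opposite_caps[OF r] by blast+
    qed
    have "E w = (rot_tile ^^ r') T5"
      using single[OF r'] opp(1) r' by blast
    then have Ew: "E w = (rot_tile ^^ r) T5"
      using opp(2)[OF r'] by simp
    have "moves_to D E'"
      unfolding E'_def by (intro move fold_move_at mE Ef Ew)
    moreover have sup: "support E' = support E - {?f1}"
      using ne Ew by (auto simp: support_def E'_def rot_tile_funpow_eq_T0 T0_eq_rot_tile_funpow)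
    have "card (support E') + card (insert k K) \<le> card (support D)"
    proof -
      have "?f1 \<in> support E"
        using Ef by (simp add: support_def rot_tile_funpow_eq_T0)
      then have "card (support E) = card (support E') + 1"
        unfolding sup using card.remove[OF E(2)] by simp
      then show ?thesis
        using E(3) cardK by simp
    qed
    moreover have "finite (support E')"
      using E(2) by (simp add: sup)
    moreover have "E' c = D c" if "\<not> odd_site c" "c \<notin> \<Union> (feet ` insert k K)" for c
      using that even[of c] w by (auto simp: E'_def k)
    moreover have "E' v = T0" if "odd_site v" "\<forall>r. (v, r) \<notin> insert k K" for v
      using that free[of v] f_even by (auto simp: E'_def k)
    moreover have "E' v = (rot_tile ^^ q) T5"
      if "(v, q) \<in> insert k K" "\<forall>q'. (v, q') \<in> insert k K \<longrightarrow> q' = q" for v q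
    proof -
      have v: "v \<noteq> w"
        using that r' insert.hyps(2) by (metis insertCI k)
      then have "(v, q) \<in> K" using that(1) by (simp add: k)
      then have "odd_site v" using insert.prems(1) by auto
      then have "E' v = E v" using v f_even by (auto simp: E'_def)
      then show ?thesis using single[OF \<open>(v, q) \<in> K\<close>] that(2) by auto
    qed
    ultimately show ?thesis
      by (intro exI[of _ E']) blast
  qed
qed

section \<open>Mosaics as diagrams\<close>

text \<open>The map \<^const>\<open>turn\<close> on integer points.\<close>

definition cell_site :: "int \<times> int \<Rightarrow> int \<times> int"
  where "cell_site = (\<lambda>(i, j). (i + j, j - i))"

definition edge_diagram :: "mosaic \<Rightarrow> diagram"
  where "edge_diagram M = (\<lambda>(a, b).
    if odd_site (a, b) \<or> ((a - b) div 2, (a + b) div 2) \<notin> grid M then T0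
    else tile_at M ((a - b) div 2, (a + b) div 2))"

lemma inj_cell_site: "inj cell_site"
  by (rule injI) (auto simp: cell_site_def split_beta prod_eq_iff)

lemma not_odd_cell_site: "\<not> odd_site (cell_site c)"
  by (cases c) (simp add: cell_site_def odd_site_def)

lemma even_site_cases:
  obtains "odd_site c" | d where "c = cell_site d"
proof (cases "odd_site c")
  case False
  obtain a b where c: "c = (a, b)" by (rule prod.exhaust)
  have "even (a - b)" "even (a + b)" using False by (simp_all add: c odd_site_def)
  then have "c = cell_site ((a - b) div 2, (a + b) div 2)"
    by (simp add: c cell_site_def) presburger
  then show ?thesis using that(2) by blast
qed (use that in blast)

lemma edge_diagram_cell_site: "edge_diagram M (cell_site c) = (if c \<in> grid M then tile_at M c else T0)"
  using not_odd_cell_site[of c] by (cases c) (simp add: edge_diagram_def cell_site_def)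

lemma edge_diagram_odd: "odd_site c \<Longrightarrow> edge_diagram M c = T0"
  by (cases c) (simp add: edge_diagram_def)

lemma site_cell_site: "site (cell_site (i, j)) = (of_int i, of_int j, 0)"
  by (simp add: site_def cell_site_def)

lemma draw_T0: "draw T0 = {}"
  by (simp add: draw_def)

lemma picture_edge_diagram:
  "picture (edge_diagram M) = (\<Union>c\<in>grid M. (+) (site (cell_site c)) ` draw (tile_at M c))" (is "?L = ?R")
proof
  show "?L \<subseteq> ?R"
  proof
    fix p assume "p \<in> ?L"
    then obtain c where c: "p \<in> (+) (site c) ` draw (edge_diagram M c)"
      unfolding picture_def by blast
    show "p \<in> ?R"
    proof (cases c rule: even_site_cases)
      case 1
      then show ?thesis using c by (simp add: edge_diagram_odd draw_T0)
    next
      case (2 d)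
      then show ?thesis using c
        by (cases "d \<in> grid M") (auto simp: edge_diagram_cell_site draw_T0)
    qed
  qed
  show "?R \<subseteq> ?L"
  proof
    fix p assume "p \<in> ?R"
    then obtain d where d: "d \<in> grid M" "p \<in> (+) (site (cell_site d)) ` draw (tile_at M d)"
      by blast
    then have "p \<in> (+) (site (cell_site d)) ` draw (edge_diagram M (cell_site d))"
      by (simp add: edge_diagram_cell_site)
    then show "p \<in> ?L" unfolding picture_def by blast
  qed
qed

lemma edge_link_edge_diagram: "ambient_isotopic (to_S3 ` picture (edge_diagram M)) (edge_link M)"
proof -
  have "centre c = (1 / 2, 1 / 2, 0) + site (cell_site c)" for c
    by (cases c) (simp add: centre_def site_cell_site)
  then have "(\<Union>c\<in>grid M. (+) (centre c) ` draw (tile_at M c)) = (+) (1 / 2, 1 / 2, 0) ` picture (edge_diagram M)"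
    by (simp add: picture_edge_diagram image_UN image_image add.assoc)
  then show ?thesis
    using isotopic_translate[of "picture (edge_diagram M)" "(1 / 2, 1 / 2, 0)"]
    by (simp add: edge_link_def isotopic_def)
qed

lemma card_support_edge_diagram:
  "finite (support (edge_diagram M))" "card (support (edge_diagram M)) = nonempty_tiles M"
proof -
  have eq: "support (edge_diagram M) = cell_site ` {c \<in> grid M. tile_at M c \<noteq> T0}" (is "?L = ?R")
  proof (rule set_eqI)
    fix c
    show "c \<in> ?L \<longleftrightarrow> c \<in> ?R"
    proof (cases c rule: even_site_cases)
      case 1
      then show ?thesis using not_odd_cell_site by (auto simp: support_def edge_diagram_odd)
    next
      case (2 d)
      then show ?thesis
        by (auto simp: support_def edge_diagram_cell_site inj_image_mem_iff[OF inj_cell_site])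
    qed
  qed
  have "finite (grid M)" by (simp add: grid_def)
  then show "finite (support (edge_diagram M))" by (simp add: eq)
  show "card (support (edge_diagram M)) = nonempty_tiles M"
    unfolding eq nonempty_tiles_def by (rule card_image) (rule inj_on_subset[OF inj_cell_site], simp)
qed

lemma edge_mosaic_ends:
  assumes "edge_mosaic M"
  shows "opposite s \<in> ends (edge_diagram M (cell_site (neighbour s c))) \<longleftrightarrow> s \<in> ends (edge_diagram M (cell_site c))"
proof -
  have *: "opposite s \<in> ends (edge_diagram M (cell_site (neighbour s c)))"
    if "s \<in> ends (edge_diagram M (cell_site c))" for s c
    using assms that by (auto simp: edge_mosaic_def edge_diagram_cell_site split: if_splits)
  have "opposite (opposite s) = s" "neighbour (opposite s) (neighbour s c) = c"
    by (cases s; cases c; simp)+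
  then show ?thesis using *[of s c] *[of "opposite s" "neighbour s c"] by auto
qed

text \<open>A side shared by two cells gets its two ends from these; the other two of the four sites around
  its midpoint are vertices of the grid, which are still empty.\<close>

lemma matched_edge_diagram:
  assumes "edge_mosaic M"
  shows "matched (edge_diagram M)"
  unfolding matched_def
proof
  fix V :: "int \<times> int"
  obtain a b where V: "V = (a, b)" by (rule prod.exhaust)
  let ?D = "edge_diagram M"
  show "degree ?D V \<in> {0, 2}"
  proof (cases "(a, b)" rule: even_site_cases)
    case 1
    then have "\<not> odd_site (a, b - 1)" by (simp add: odd_site_def)
    then obtain i j where ij: "(a, b - 1) = cell_site (i, j)"
      by (metis even_site_cases prod.exhaust)
    then have "(a - 1, b) = cell_site (neighbour Left (i, j))"
      by (auto simp: cell_site_def)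
    then have "Right \<in> ends (?D (a - 1, b)) \<longleftrightarrow> Left \<in> ends (?D (a, b - 1))"
      using edge_mosaic_ends[OF assms, of Left "(i, j)"] ij by simp
    moreover have "?D (a, b) = T0" "?D (a - 1, b - 1) = T0"
      using 1 by (simp_all add: edge_diagram_odd odd_site_def)
    ultimately show ?thesis by (auto simp: V degree_def)
  next
    case (2 c)
    obtain i j where c: "c = (i, j)" by (rule prod.exhaust)
    then have "(a - 1, b - 1) = cell_site (neighbour Bottom (i, j))"
      using 2 by (auto simp: cell_site_def)
    then have "Top \<in> ends (?D (a - 1, b - 1)) \<longleftrightarrow> Bottom \<in> ends (?D (a, b))"
      using edge_mosaic_ends[OF assms, of Bottom "(i, j)"] 2 c by simp
    moreover have "odd_site (a, b - 1)" "odd_site (a - 1, b)"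
      using not_odd_cell_site[of c] unfolding 2[symmetric] by (simp_all add: odd_site_def)
    then have "?D (a, b - 1) = T0" "?D (a - 1, b) = T0"
      by (simp_all add: edge_diagram_odd)
    ultimately show ?thesis by (auto simp: V degree_def)
  qed
qed

text \<open>The counting in the definition of corner mosaics agrees with \<^const>\<open>degree\<close>.\<close>

lemma card_incident:
  "card {(c, s). s \<in> ends (D c) \<and> corner s c = V} = degree D V"
proof -
  obtain a b where V: "V = (a, b)" by (rule prod.exhaust)
  let ?A = "{((a, b - 1), Left), ((a, b), Bottom), ((a - 1, b), Right), ((a - 1, b - 1), Top)}"
  have "(c, s) \<in> ?A" if "corner s c = V" for c s
    using that by (cases s; cases c) (auto simp: V)
  then have "{(c, s). s \<in> ends (D c) \<and> corner s c = V} = ?A \<inter> {p. snd p \<in> ends (D (fst p))}"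
    by (auto simp: V)
  also have "card \<dots> = (\<Sum>p\<in>?A. of_bool (snd p \<in> ends (D (fst p))))"
    by simp
  also have "\<dots> = degree D V"
    by (simp add: V degree_def)
  finally show ?thesis .
qed

lemma turn_spiral: "turn = spiral 1 (- 1)"
  by (auto simp: turn_def spiral_def fun_eq_iff)

text \<open>Shift the diagram into the positive quadrant and turn its picture.\<close>

lemma corner_mosaic_of_diagram:
  assumes "matched D" "finite (support D)"
  obtains N where "corner_mosaic N" "nonempty_tiles N = card (support D)"
    "ambient_isotopic (to_S3 ` picture D) (corner_link N)"
proof -
  obtain n :: nat where n: "\<And>a b. (a, b) \<in> support D \<Longrightarrow> \<bar>a\<bar> < int n \<and> \<bar>b\<bar> < int n"
  proof -
    define m where "m = Max (insert 0 ((\<lambda>(a, b). \<bar>a\<bar> + \<bar>b\<bar>) ` support D))"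
    have m: "\<bar>a\<bar> + \<bar>b\<bar> \<le> m" if "(a, b) \<in> support D" for a b
      unfolding m_def using assms(2) that by (intro Max_ge) (auto intro!: rev_image_eqI)
    have "0 \<le> m" unfolding m_def using assms(2) by (intro Max_ge) auto
    have "\<bar>a\<bar> < int (nat (m + 1)) \<and> \<bar>b\<bar> < int (nat (m + 1))" if "(a, b) \<in> support D" for a b
      using m[OF that] \<open>0 \<le> m\<close> by auto
    then show ?thesis by (rule that)
  qed
  define w where "w = (int n, int n)"
  define N where "N = \<lparr>width = 2 * n, height = 2 * n, tile_at = translate w D\<rparr>"
  have in_grid: "c \<in> grid N" if "translate w D c \<noteq> T0" for c
  proof -
    have "c - w \<in> support D" using that by (simp add: translate_def support_def)
    then show ?thesis
      using n[of "fst c - int n" "snd c - int n"] by (cases c) (auto simp: grid_def N_def w_def)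
  qed
  have tile_N: "tile_at N = translate w D" by (simp add: N_def)
  have "corner_mosaic N"
    unfolding corner_mosaic_def
  proof
    fix V :: "int \<times> int"
    have "{(c, s). c \<in> grid N \<and> s \<in> ends (tile_at N c) \<and> corner s c = V}
        = {(c, s). s \<in> ends (translate w D c) \<and> corner s c = V}"
      using in_grid by (force simp: tile_N)
    then show "card {(c, s). c \<in> grid N \<and> s \<in> ends (tile_at N c) \<and> corner s c = V} \<in> {0, 2}"
      using assms(1) by (simp only: card_incident degree_translate matchedD not_False_eq_True)
  qed
  moreover have "nonempty_tiles N = card (support D)"
  proof -
    have "{c \<in> grid N. tile_at N c \<noteq> T0} = (+) w ` support D"
    proof (intro equalityI subsetI)
      fix c assume "c \<in> {c \<in> grid N. tile_at N c \<noteq> T0}"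
      then show "c \<in> (+) w ` support D"
        by (intro image_eqI[of _ _ "c - w"]) (auto simp: tile_N translate_def support_def)
    next
      fix c assume "c \<in> (+) w ` support D"
      then have "translate w D c \<noteq> T0" by (auto simp: translate_def support_def)
      then show "c \<in> {c \<in> grid N. tile_at N c \<noteq> T0}" using in_grid by (simp add: tile_N)
    qed
    then show ?thesis by (simp add: nonempty_tiles_def card_image)
  qed
  moreover have "ambient_isotopic (to_S3 ` picture D) (corner_link N)"
  proof -
    let ?D = "translate w D"
    have c: "centre c = (1 / 2, 1 / 2, 0) + turn (site c)" for c
      by (cases c) (simp add: centre_def site_def turn_def field_simps)
    have "(\<Union>c\<in>grid N. (+) (centre c) ` turn ` draw (tile_at N c)) = (\<Union>c. (+) (centre c) ` turn ` draw (?D c))"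
    proof (intro equalityI UN_least)
      fix c
      show "(+) (centre c) ` turn ` draw (?D c) \<subseteq> (\<Union>c\<in>grid N. (+) (centre c) ` turn ` draw (tile_at N c))"
      proof (cases "?D c = T0")
        case False
        then show ?thesis using in_grid unfolding tile_N by (intro UN_upper)
      qed (simp add: draw_T0)
    qed (auto simp: tile_N)
    also have "\<dots> = (+) (1 / 2, 1 / 2, 0) ` turn ` picture ?D"
      by (simp add: c picture_def image_UN image_image turn_spiral spiral_add add.assoc)
    finally have "corner_link N = to_S3 ` (+) (1 / 2, 1 / 2, 0) ` turn ` picture ?D"
      by (simp add: corner_link_def)
    moreover have "isotopic (picture D) (picture ?D)"
      unfolding picture_translate by (rule isotopic_translate)
    moreover have "isotopic (picture ?D) (turn ` picture ?D)"
      unfolding turn_spiral by (rule isotopic_spiral) simp_all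
    moreover have "isotopic (turn ` picture ?D) ((+) (1 / 2, 1 / 2, 0) ` turn ` picture ?D)"
      by (rule isotopic_translate)
    ultimately show ?thesis
      using isotopic_trans unfolding isotopic_def by metis
  qed
  ultimately show ?thesis by (rule that)
qed

section \<open>Saving a tile for every cap\<close>

text \<open>The four rotations \<open>\<inter>\<close>, \<open>\<subset>\<close>, \<open>\<union>\<close>, \<open>\<supset>\<close> are reached from \<open>\<inter>\<close> by \<open>0\<close>, \<open>1\<close>, \<open>2\<close>, \<open>3\<close> counterclockwise
  quarter turns. The vertex is the end point of the shared side that lies inside the bend.\<close>

lemma is_cap_imp_cap_at:
  assumes "is_cap M c d"
  obtains k where "cap_at (edge_diagram M) k" "cell_site ` {c, d} = feet k"
proof -
  obtain i j where c: "c = (i, j)" by (rule prod.exhaust)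
  let ?D = "edge_diagram M"
  have D: "?D (cell_site c) = tile_at M c" "?D (cell_site d) = tile_at M d"
    using assms by (simp_all add: edge_diagram_cell_site is_cap_def)
  have powers: "(quarter ^^ 2) (0, 1) = (0, -1)" "(quarter ^^ 2) (1, 0) = (-1, 0)"
    "(quarter ^^ 3) (0, 1) = (1, 0)" "(quarter ^^ 3) (1, 0) = (0, -1)"
    "quarter (0, 1) = (-1, 0)" "quarter (1, 0) = (0, 1)"
    "(rot_tile ^^ 2) T2 = T4" "(rot_tile ^^ 2) T1 = T3" "(rot_tile ^^ 3) T2 = T1" "(rot_tile ^^ 3) T1 = T4"
    by (simp_all add: numeral_2_eq_2 numeral_3_eq_3 quarter_def)
  consider "d = (i + 1, j)" "tile_at M c = T2" "tile_at M d = T1"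
    | "d = (i, j + 1)" "tile_at M c = T3" "tile_at M d = T2"
    | "d = (i + 1, j)" "tile_at M c = T3" "tile_at M d = T4"
    | "d = (i, j + 1)" "tile_at M c = T4" "tile_at M d = T1"
    using assms by (auto simp: is_cap_def c)
  then show ?thesis
  proof cases
    case 1
    then show ?thesis using D
      by (intro that[of "((i + j, j - i - 1), 0)"]) (auto simp: c cell_site_def odd_site_def algebra_simps)
  next
    case 2
    then show ?thesis using D
      by (intro that[of "((i + j + 1, j - i), 1)"]) (auto simp: c cell_site_def odd_site_def powers algebra_simps)
  next
    case 3
    then show ?thesis using D
      by (intro that[of "((i + j + 1, j - i), 2)"]) (auto simp: c cell_site_def odd_site_def powers algebra_simps)
  next
    case 4
    then show ?thesis using D
      by (intro that[of "((i + j, j - i + 1), 3)"]) (auto simp: c cell_site_def odd_site_def powers algebra_simps)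
  qed
qed

lemma num_caps_attained:
  obtains K where "K \<subseteq> {{c, d} | c d. is_cap M c d}" "pairwise disjnt K" "finite K" "card K = num_caps M"
proof -
  let ?C = "{{c, d} | c d. is_cap M c d}"
  let ?N = "{card K | K. K \<subseteq> ?C \<and> pairwise disjnt K}"
  have "finite (Pow (grid M))" by (simp add: grid_def)
  then have fin: "finite ?C"
    by (rule finite_subset[rotated]) (auto simp: is_cap_def)
  have "?N \<subseteq> card ` Pow ?C" by auto
  then have "finite ?N" by (rule finite_subset) (use fin in simp)
  moreover have "card {} \<in> ?N" by (intro CollectI exI[of _ "{}"]) simp
  ultimately have "num_caps M \<in> ?N"
    unfolding num_caps_def by (intro Max_in) auto
  then obtain K where K: "num_caps M = card K" "K \<subseteq> ?C" "pairwise disjnt K"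
    by (elim CollectE exE conjE)
  show ?thesis
    by (rule that[OF K(2,3) finite_subset[OF K(2) fin] K(1)[symmetric]])
qed

lemma corner_mosaic_saving_caps:
  assumes "edge_mosaic M"
  obtains N where "corner_mosaic N" "nonempty_tiles N + num_caps M \<le> nonempty_tiles M"
    "ambient_isotopic (corner_link N) (edge_link M)"
proof -
  let ?D = "edge_diagram M"
  obtain K where K: "K \<subseteq> {{c, d} | c d. is_cap M c d}" "pairwise disjnt K" "finite K" "card K = num_caps M"
    by (rule num_caps_attained)
  have "\<forall>k\<in>K. \<exists>l. cap_at ?D l \<and> cell_site ` k = feet l"
  proof
    fix k assume "k \<in> K"
    then obtain c d where "k = {c, d}" "is_cap M c d" using K(1) by auto
    then show "\<exists>l. cap_at ?D l \<and> cell_site ` k = feet l"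
      using is_cap_imp_cap_at[of M c d] by metis
  qed
  then obtain \<phi> where \<phi>: "\<And>k. k \<in> K \<Longrightarrow> cap_at ?D (\<phi> k) \<and> cell_site ` k = feet (\<phi> k)"
    by metis
  have inj: "inj_on \<phi> K"
    using \<phi> inj_image_eq_iff[OF inj_cell_site] by (metis inj_onI)
  have "feet (\<phi> k) \<inter> feet (\<phi> l) = {}" if "k \<in> K" "l \<in> K" "\<phi> k \<noteq> \<phi> l" for k l
  proof -
    have "k \<noteq> l" using that(3) by blast
    then have "k \<inter> l = {}" using pairwiseD[OF K(2) that(1,2)] by (simp add: disjnt_def)
    then have "cell_site ` k \<inter> cell_site ` l = {}"
      by (simp flip: image_Int[OF inj_cell_site])
    then show ?thesis using \<phi> that by simp
  qed
  then have disj: "\<forall>k\<in>\<phi> ` K. \<forall>l\<in>\<phi> ` K. k \<noteq> l \<longrightarrow> feet k \<inter> feet l = {}"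
    by blast
  have caps: "\<forall>k\<in>\<phi> ` K. cap_at ?D k" and fin: "finite (\<phi> ` K)"
    using \<phi> K(3) by auto
  obtain E where E: "moves_to ?D E" "finite (support E)" "card (support E) + card (\<phi> ` K) \<le> card (support ?D)"
  proof -
    have "\<forall>w. odd_site w \<longrightarrow> ?D w = T0" by (simp add: edge_diagram_odd)
    from straighten_caps[OF fin caps disj matched_edge_diagram[OF assms] card_support_edge_diagram(1) this]
    show thesis by (elim exE conjE) (rule that)
  qed
  obtain N where N: "corner_mosaic N" "nonempty_tiles N = card (support E)"
    "ambient_isotopic (to_S3 ` picture E) (corner_link N)"
    using corner_mosaic_of_diagram[of E] E by (auto simp: moves_to_def)
  have S3: "to_S3 ` X \<subseteq> S3" for X using to_S3_in_S3 by blast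
  have "ambient_isotopic (corner_link N) (to_S3 ` picture E)"
    using N(3) by (rule ambient_isotopic_sym) (rule S3)
  moreover have "ambient_isotopic (to_S3 ` picture E) (to_S3 ` picture ?D)"
    using E(1) isotopic_sym by (simp add: moves_to_def isotopic_def)
  moreover have "ambient_isotopic (to_S3 ` picture ?D) (edge_link M)"
    by (rule edge_link_edge_diagram)
  ultimately have "ambient_isotopic (corner_link N) (edge_link M)"
    using ambient_isotopic_trans by blast
  moreover have "nonempty_tiles N + num_caps M \<le> nonempty_tiles M"
    using E(3) N(2) K(4) card_image[OF inj] card_support_edge_diagram(2)[of M] by simp
  ultimately show ?thesis using N(1) that by blast
qed

theorem theorem1:
  fixes L :: "(point \<times> real) set"
  assumes "tame_link L"
  shows "corner_tile_number L + caps L \<le> edge_tile_number L"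
proof (cases "edge_tile_number L")
  case (enat n)
  have "edge_mosaics L \<noteq> {}"
    using enat by (auto simp: edge_tile_number_def top_enat_def)
  then obtain M0 where M0: "M0 \<in> edge_mosaics L" "enat (nonempty_tiles M0) = edge_tile_number L"
    unfolding edge_tile_number_def using Inf_enat_def[of "(\<lambda>M. enat (nonempty_tiles M)) ` edge_mosaics L"]
    by (metis (mono_tags, lifting) LeastI_ex equals0I imageE image_is_empty imageI ex_in_conv)
  have saving: "corner_tile_number L + enat (num_caps M) \<le> enat n" if "M \<in> minimal_edge_mosaics L" for M
  proof -
    have M: "edge_mosaic M" "ambient_isotopic (edge_link M) L" "nonempty_tiles M = n"
      using that enat by (auto simp: minimal_edge_mosaics_def edge_mosaics_def)
    obtain N where N: "corner_mosaic N" "nonempty_tiles N + num_caps M \<le> nonempty_tiles M"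
      "ambient_isotopic (corner_link N) (edge_link M)"
      using M(1) by (rule corner_mosaic_saving_caps)
    have "N \<in> corner_mosaics L"
      using N(1) ambient_isotopic_trans[OF N(3) M(2)] by (simp add: corner_mosaics_def)
    then have "corner_tile_number L \<le> enat (nonempty_tiles N)"
      unfolding corner_tile_number_def by (rule INF_lower)
    then have "corner_tile_number L + enat (num_caps M) \<le> enat (nonempty_tiles N + num_caps M)"
      by (simp add: add_right_mono flip: plus_enat_simps(1))
    also have "\<dots> \<le> enat n" using N(2) M(3) by simp
    finally show ?thesis .
  qed
  have "M0 \<in> minimal_edge_mosaics L" using M0 by (simp add: minimal_edge_mosaics_def)
  from saving[OF this] obtain m where m: "corner_tile_number L = enat m"
    by (cases "corner_tile_number L") auto
  have "caps L \<le> enat (n - m)"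
    unfolding caps_def
  proof (rule SUP_least)
    fix M assume "M \<in> minimal_edge_mosaics L"
    from saving[OF this] show "enat (num_caps M) \<le> enat (n - m)" by (simp add: m)
  qed
  moreover have "m \<le> n" using saving[OF \<open>M0 \<in> minimal_edge_mosaics L\<close>] by (simp add: m)
  ultimately have "enat m + caps L \<le> enat m + enat (n - m)" by (intro add_left_mono)
  then show ?thesis using \<open>m \<le> n\<close> by (simp add: m enat)
qed simp

end
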